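(* Suppose the spectral values of $\mathcal{L}$ satisfy: for all $\sigma,\sigma'\in\mathrm{Spec}(\mathcal{L})$, $\mathrm{Re}(\sigma)=\mathrm{Re}(\sigma')$ implies $\sigma=\sigma'$. Let $u$ be a solution of $\mathcal{L}u=0$ in $A(0,R)=(0,R)\times\mathbb{S}^1$ that has finite order along $S_0=\{0\}\times\mathbb{S}^1$, and suppose there is a sequence $(r_k,t_k)\in A(0,R)$ with $r_k\to0$ and $u(r_k,t_k)=0$ for all $k$. Then $u\equiv0$.
   Context: Fix $a>0$, $b\in\mathbb{R}\setminus\{0\}$, $\lambda=a+ib$, $\nu\in[0,1)$, an integer $k\ge2$ and $c\in C^k(\mathbb{S}^1,\mathbb{C})$. On $(0,\infty)\times\mathbb{S}^1$ (coordinates $(r,t)$) let $\mathcal{L}u=\lambda u_t-iru_r+i\lambda\nu u-c(t)\bar u$. A basic solution of $\mathcal{L}$ is a nontrivial solution of $\mathcal{L}w=0$ on $(0,\infty)\times\mathbb{S}^1$ of the form $w=r^\sigma\phi(t)+\overline{r^\sigma\psi(t)}$, $\sigma\in\mathbb{C}$, $\phi,\psi$ $2\pi$-periodic, written with $|\phi|>|\psi|$ when $\sigma\notin\mathbb{R}$ and as $r^\sigma f$ when $\sigma\in\mathbb{R}$; $\sigma$ is its exponent, and $\mathrm{Spec}(\mathcal{L})$ is the set of exponents. For each $j\in\mathbb{Z}$ there are exactly two $\mathbb{R}$-independent basic solutions $w_j^\pm$ with winding number $j$ and exponents $\sigma_j^\pm$, and every solution $u$ of $\mathcal{L}u=0$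 in $A(0,R)$ admits a convergent expansion $u=\sum_{j\in\mathbb{Z}}(a_j^+w_j^++a_j^-w_j^-)$ with $a_j^\pm\in\mathbb{R}$ (Laurent expansion). $u$ has finite order along $S_0$ if there is $s\in\mathbb{R}$ such that in its Laurent expansion $a_j^\pm=0$ whenever $\mathrm{Re}(\sigma_j^\pm)<s$. *)

theory Defs
  imports "HOL-Analysis.Analysis"
begin

text \<open>Functions on (0,\<infinity>) x S^1 are modelled as functions u :: real \<times> real \<Rightarrow> complex
  of (r,t), 2pi-periodic in t.  r^\<sigma> for r > 0 is  (of_real r) powr \<sigma>.\<close>

definition rpow :: "real \<Rightarrow> complex \<Rightarrow> complex" where
  "rpow r \<sigma> = (of_real r) powr \<sigma>"

definition Ck_circle :: "nat \<Rightarrow> (real \<Rightarrow> complex) \<Rightarrow> bool" where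
  "Ck_circle k c \<longleftrightarrow> (\<forall>t. c (t + 2*pi) = c t) \<and>
     (\<exists>f :: nat \<Rightarrow> real \<Rightarrow> complex. f 0 = c \<and>
        (\<forall>i<k. \<forall>t. (f i has_vector_derivative f (Suc i) t) (at t)) \<and>
        continuous_on UNIV (f k))"

definition L_solution ::
  "complex \<Rightarrow> real \<Rightarrow> (real \<Rightarrow> complex) \<Rightarrow> real set \<Rightarrow> (real \<times> real \<Rightarrow> complex) \<Rightarrow> bool" where
  "L_solution lam nu c S u \<longleftrightarrow>
     (\<forall>r\<in>S. \<forall>t. u (r, t + 2*pi) = u (r, t)) \<and>
     (\<forall>r\<in>S. \<forall>t. \<exists>D. (u has_derivative D) (at (r, t)) \<and>
        lam * D (0, 1) - \<i> * of_real r * D (1, 0) + \<i> * lam * of_real nu * u (r, t)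
          - c t * cnj (u (r, t)) = 0)"

text \<open>Basic solution with exponent \<sigma>: a nontrivial solution on (0,\<infinity>) x S^1 of the form
  r^\<sigma> \<phi>(t) + conj(r^\<sigma> \<psi>(t)), with |\<phi>| > |\<psi>| when \<sigma> is not real
  (for real \<sigma> this is just r^\<sigma> f with f = \<phi> + conj \<psi>).\<close>
definition basic_solution ::
  "complex \<Rightarrow> real \<Rightarrow> (real \<Rightarrow> complex) \<Rightarrow> (real \<times> real \<Rightarrow> complex) \<Rightarrow> complex \<Rightarrow> bool" where
  "basic_solution lam nu c w \<sigma> \<longleftrightarrow>
     L_solution lam nu c {0<..} w \<and>
     (\<exists>r t. 0 < r \<and> w (r, t) \<noteq> 0) \<and>
     (\<exists>\<phi> \<psi> :: real \<Rightarrow> complex.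
        (\<forall>t. \<phi> (t + 2*pi) = \<phi> t \<and> \<psi> (t + 2*pi) = \<psi> t) \<and>
        (\<forall>r t. 0 < r \<longrightarrow> w (r, t) = rpow r \<sigma> * \<phi> t + cnj (rpow r \<sigma> * \<psi> t)) \<and>
        (\<sigma> \<in> \<real> \<or> (\<forall>t. norm (\<psi> t) < norm (\<phi> t))))"

definition Spec :: "complex \<Rightarrow> real \<Rightarrow> (real \<Rightarrow> complex) \<Rightarrow> complex set" where
  "Spec lam nu c = {\<sigma>. \<exists>w. basic_solution lam nu c w \<sigma>}"

definition has_winding :: "(real \<times> real \<Rightarrow> complex) \<Rightarrow> int \<Rightarrow> bool" where
  "has_winding w j \<longleftrightarrow> (\<forall>t. w (1, t) \<noteq> 0) \<and>
     (\<exists>\<theta> :: real \<Rightarrow> real. continuous_on {0..2*pi} \<theta> \<and>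
        (\<forall>t\<in>{0..2*pi}. w (1, t) = of_real (norm (w (1, t))) * exp (\<i> * of_real (\<theta> t))) \<and>
        \<theta> (2*pi) - \<theta> 0 = 2 * pi * of_int j)"

definition R_independent :: "(real \<times> real \<Rightarrow> complex) \<Rightarrow> (real \<times> real \<Rightarrow> complex) \<Rightarrow> bool" where
  "R_independent w1 w2 \<longleftrightarrow>
     (\<forall>x y :: real. (\<forall>r t. 0 < r \<longrightarrow> of_real x * w1 (r, t) + of_real y * w2 (r, t) = 0)
        \<longrightarrow> x = 0 \<and> y = 0)"

text \<open>Finite order along S_0: the Laurent expansion of u in A(0,R) with respect to the basic
  solutions w_j^{\<pm>} (index True = +, False = -) has a_j^{\<pm>} = 0 whenever
  Re(\<sigma>_j^{\<pm>}) < s, for some real s.\<close>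
definition finite_order ::
  "complex \<Rightarrow> real \<Rightarrow> (real \<Rightarrow> complex) \<Rightarrow> real \<Rightarrow> (real \<times> real \<Rightarrow> complex) \<Rightarrow> bool" where
  "finite_order lam nu c R u \<longleftrightarrow>
     (\<exists>(s::real) (w :: int \<Rightarrow> bool \<Rightarrow> real \<times> real \<Rightarrow> complex) (\<sigma> :: int \<Rightarrow> bool \<Rightarrow> complex)
        (a :: int \<Rightarrow> bool \<Rightarrow> real).
        (\<forall>j. basic_solution lam nu c (w j True) (\<sigma> j True) \<and>
             basic_solution lam nu c (w j False) (\<sigma> j False) \<and>
             has_winding (w j True) j \<and> has_winding (w j False) j \<and>
             R_independent (w j True) (w j False)) \<and>
        (\<forall>r t. 0 < r \<and> r < R \<longrightarrow>
           ((\<lambda>j. of_real (a j True) * w j True (r, t) + of_real (a j False) * w j False (r, t))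
              has_sum u (r, t)) UNIV) \<and>
        (\<forall>j b. Re (\<sigma> j b) < s \<longrightarrow> a j b = 0))"

end

theory Submission
  imports Defs
begin

text \<open>
  A basic solution \<open>r\<^sup>\<sigma> \<phi> + cnj (r\<^sup>\<sigma> \<psi>)\<close> comes from a periodic solution \<open>(\<phi>, \<psi>)\<close> of a complex
  linear system. An energy identity for \<open>|\<phi>|\<^sup>2 - |\<psi>|\<^sup>2\<close> shows that all nontrivial real
  combinations of basic solutions with a common exponent \<open>\<sigma>\<close> vanish nowhere; hence they have
  a common winding number. Integrating \<open>\<phi>'/\<phi>\<close> over the circle shows that an exponent of winding
  number \<open>j\<close> lies within \<open>sup |c|\<close> of \<open>\<lambda> (\<nu> + j)\<close>, so a solution of finite order has a smallest
  real part \<open>\<tau>\<close> of an occurring exponent. By the spectral hypothesis, all terms with this real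
  part have the same exponent, so their sum is bounded below by a multiple of \<open>r\<^sup>\<tau>\<close>.

  For the remaining terms, the Riccati equation for \<open>\<psi>/\<phi>\<close> shows that for large \<open>|j|\<close> the two
  exponents of winding number \<open>j\<close> coincide and \<open>|\<psi>| \<le> |\<phi>|/2\<close>. Together with a Harnack inequality for
  \<open>\<phi>\<close> that is uniform in \<open>j\<close>, the absolute convergence of the expansion at a single point makes
  the tail \<open>O(r\<^bsup>\<tau>+1\<^esup>)\<close> uniformly in \<open>t\<close>. Thus \<open>u\<close> cannot vanish for small \<open>r\<close> unless all
  coefficients are zero.
\<close>

subsection \<open>Periodic functions and winding numbers\<close>

lemma periodic_int_shift:
  fixes f :: "real \<Rightarrow> 'a"
  assumes "\<And>t. f (t + 2*pi) = f t"
  shows "f (t + 2*pi * of_int n) = f t"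
proof -
  have nat: "f (t + 2*pi * of_nat m) = f t" for t m
  proof (induction m)
    case (Suc m)
    have "t + 2*pi * of_nat (Suc m) = (t + 2*pi * of_nat m) + 2*pi" by (simp add: algebra_simps)
    then show ?case using assms Suc by metis
  qed simp
  show ?thesis
  proof (cases "n \<ge> 0")
    case True
    then show ?thesis using nat[of t "nat n"] by simp
  next
    case False
    then show ?thesis using nat[of "t + 2*pi * of_int n" "nat (-n)"] by simp
  qed
qed

lemma circle_representative: "\<exists>n::int. t + 2*pi * of_int n \<in> {0..2*pi}"
proof -
  define x where "x = t / (2*pi)"
  have t: "t = x * (2*pi)" by (simp add: x_def)
  have "of_int \<lfloor>x\<rfloor> * (2*pi) \<le> x * (2*pi)" "x * (2*pi) \<le> (of_int \<lfloor>x\<rfloor> + 1) * (2*pi)"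
    by (rule mult_right_mono; (linarith | simp))+
  then show ?thesis by (intro exI[of _ "- \<lfloor>x\<rfloor>"]) (simp add: t algebra_simps)
qed

lemma periodic_attains_max:
  fixes g :: "real \<Rightarrow> real"
  assumes "\<And>t. g (t + 2*pi) = g t" and "continuous_on UNIV g"
  shows "\<exists>m. \<forall>t. g t \<le> g m"
proof -
  have "continuous_on {0..2*pi} g" using assms(2) continuous_on_subset by blast
  then obtain m where m: "\<forall>t\<in>{0..2*pi}. g t \<le> g m"
    using continuous_attains_sup[of "{0..2*pi}" g] by auto
  have "g t \<le> g m" for t
    using circle_representative[of t] m periodic_int_shift[of g t, OF assms(1)] by metis
  then show ?thesis by blast
qed

section \<open>Maximum principle and Gronwall estimate\<close>

lemma has_real_derivative_norm_squared:
  fixes f :: "real \<Rightarrow> complex"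
  assumes "(f has_vector_derivative d) (at t)"
  shows "((\<lambda>t. (norm (f t))\<^sup>2) has_real_derivative 2 * Re (cnj (f t) * d)) (at t)"
proof -
  have "((\<lambda>t. f t \<bullet> f t) has_derivative (\<lambda>h. f t \<bullet> (h *\<^sub>R d) + (h *\<^sub>R d) \<bullet> f t)) (at t)"
    using assms unfolding has_vector_derivative_def by (intro has_derivative_inner)
  moreover have "(\<lambda>h. f t \<bullet> (h *\<^sub>R d) + (h *\<^sub>R d) \<bullet> f t) = (*) (2 * Re (cnj (f t) * d))"
    by (rule ext) (simp add: inner_complex_def algebra_simps)
  ultimately show ?thesis
    by (simp add: has_field_derivative_def power2_norm_eq_inner)
qed

text \<open>At a maximum of the modulus the derivative of the squared modulus vanishes.\<close>
lemma periodic_norm_bound: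
  fixes q :: "real \<Rightarrow> complex"
  assumes per: "\<And>t. q (t + 2*pi) = q t"
    and der: "\<And>t. (q has_vector_derivative q' t) (at t)"
    and bd: "\<And>t. norm (q' t - \<mu> * q t) \<le> B"
  shows "\<bar>Re \<mu>\<bar> * norm (q t) \<le> B"
proof -
  have der2: "((\<lambda>t. (norm (q t))\<^sup>2) has_real_derivative 2 * Re (cnj (q t) * q' t)) (at t)" for t
    by (rule has_real_derivative_norm_squared[OF der])
  then have "continuous_on UNIV (\<lambda>t. (norm (q t))\<^sup>2)"
    by (meson DERIV_isCont continuous_at_imp_continuous_on)
  then obtain m where m: "\<And>t. (norm (q t))\<^sup>2 \<le> (norm (q m))\<^sup>2"
    using periodic_attains_max[of "\<lambda>t. (norm (q t))\<^sup>2"] per by auto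
  have "2 * Re (cnj (q m) * q' m) = 0"
    using DERIV_local_max[OF der2[of m], of 1] m by auto
  \<comment> \<open>Since \<open>Re (cnj q * q')\<close> vanishes at \<open>m\<close>, the linear
    part \<open>\<mu> * q\<close> is balanced there by the error, whose norm is at most
    \<open>B\<close>.\<close>
  moreover have "cnj (q m) * q' m = \<mu> * (cnj (q m) * q m) + cnj (q m) * (q' m - \<mu> * q m)"
    by (simp add: algebra_simps)
  moreover have "cnj (q m) * q m = of_real ((norm (q m))\<^sup>2)"
    by (metis complex_norm_square mult.commute)
  ultimately have "Re \<mu> * (norm (q m))\<^sup>2 = - Re (cnj (q m) * (q' m - \<mu> * q m))"
    by simp
  then have "\<bar>Re \<mu>\<bar> * (norm (q m))\<^sup>2 = \<bar>Re (cnj (q m) * (q' m - \<mu> * q m))\<bar>"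
    by (metis abs_minus_cancel abs_mult abs_power2)
  also have "\<dots> \<le> norm (q m) * norm (q' m - \<mu> * q m)"
    by (metis abs_Re_le_cmod complex_mod_cnj norm_mult)
  also have "\<dots> \<le> norm (q m) * B" by (intro mult_left_mono bd) simp
  finally have 1: "norm (q m) * (\<bar>Re \<mu>\<bar> * norm (q m)) \<le> norm (q m) * B"
    by (simp add: power2_eq_square mult_ac)
  have B: "0 \<le> B" using bd[of 0] norm_ge_zero order_trans by blast
  have "\<bar>Re \<mu>\<bar> * norm (q m) \<le> B"
  proof (cases "q m = 0")
    case False
    then show ?thesis using 1 by simp
  qed (use B in simp)
  moreover have "norm (q t) \<le> norm (q m)" using m[of t] by simp
  ultimately show ?thesis
    by (meson abs_ge_zero mult_left_mono order_trans)
qed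

text \<open>The hypothesis makes \<open>g t * exp (- C * t)\<close> nonincreasing and
  \<open>g t * exp (C * t)\<close> nondecreasing; the first serves for \<open>t\<close> after
  \<open>s\<close>, the second for \<open>t\<close> before \<open>s\<close>.\<close>

lemma gronwall_two_sided:
  fixes g :: "real \<Rightarrow> real"
  assumes der: "\<And>t. (g has_real_derivative g' t) (at t)"
    and bd: "\<And>t. \<bar>g' t\<bar> \<le> C * g t"
  shows "g t \<le> g s * exp (C * \<bar>t - s\<bar>)"
proof (cases "s \<le> t")
  case True
  have "g t * exp (- C * t) \<le> g s * exp (- C * s)"
  proof (rule DERIV_nonpos_imp_nonincreasing[OF True])
    fix x
    have "((\<lambda>t. g t * exp (- C * t)) has_real_derivative (g' x - C * g x) * exp (- C * x)) (at x)"
      by (rule derivative_eq_intros der refl | simp add: algebra_simps)+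
    moreover have "(g' x - C * g x) * exp (- C * x) \<le> 0"
      using bd[of x] by (intro mult_nonpos_nonneg) auto
    ultimately show "\<exists>y. ((\<lambda>t. g t * exp (- C * t)) has_real_derivative y) (at x) \<and> y \<le> 0"
      by blast
  qed
  then have "g t * exp (- C * t) * exp (C * t) \<le> g s * exp (- C * s) * exp (C * t)"
    by (intro mult_right_mono) auto
  then show ?thesis using True
    by (simp add: mult.assoc flip: exp_add) (simp add: algebra_simps)
next
  case False
  then have le: "t \<le> s" by simp
  have "g t * exp (C * t) \<le> g s * exp (C * s)"
  proof (rule DERIV_nonneg_imp_nondecreasing[OF le])
    fix x
    have "((\<lambda>t. g t * exp (C * t)) has_real_derivative (g' x + C * g x) * exp (C * x)) (at x)"
      by (rule derivative_eq_intros der refl | simp add: algebra_simps)+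
    moreover have "(g' x + C * g x) * exp (C * x) \<ge> 0"
      using bd[of x] by (intro mult_nonneg_nonneg) auto
    ultimately show "\<exists>y. ((\<lambda>t. g t * exp (C * t)) has_real_derivative y) (at x) \<and> y \<ge> 0"
      by blast
  qed
  then have "g t * exp (C * t) * exp (- C * t) \<le> g s * exp (C * s) * exp (- C * t)"
    by (intro mult_right_mono) auto
  then show ?thesis using False
    by (simp add: mult.assoc flip: exp_add) (simp add: algebra_simps)
qed

text \<open>The difference of two logarithms takes values in the discrete set 2 pi i Z, so by
  continuity it is constant on the interval.\<close>

lemma exp_eq_imp_increment_eq:
  fixes h k :: "real \<Rightarrow> complex"
  assumes "continuous_on {0..2*pi} h" "continuous_on {0..2*pi} k"
    and eq: "\<And>t. t \<in> {0..2*pi} \<Longrightarrow> exp (h t) = exp (k t)"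
  shows "h (2*pi) - h 0 = k (2*pi) - k 0"
proof -
  define d where "d t = h t - k t" for t
  have d: "exp (d t) = 1" if "t \<in> {0..2*pi}" for t
    using eq[OF that] by (simp add: d_def exp_diff)
  have "d constant_on {0..2*pi}"
  proof (rule continuous_discrete_range_constant)
    show "continuous_on {0..2*pi} d" unfolding d_def by (intro continuous_intros assms)
    fix x assume x: "x \<in> {0..2*pi}"
    show "\<exists>e>0. \<forall>y. y \<in> {0..2*pi} \<and> d y \<noteq> d x \<longrightarrow> e \<le> norm (d y - d x)"
    proof (intro exI[of _ 1] conjI allI impI)
      fix y assume y: "y \<in> {0..2*pi} \<and> d y \<noteq> d x"
      then have "exp (d y - d x) = 1" using d x by (simp add: exp_diff)
      then obtain n where n: "Re (d y - d x) = 0" "Im (d y - d x) = of_int (2 * n) * pi"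
        using exp_eq_1[THEN iffD1] by blast
      then have "d y - d x = \<i> * of_real (of_int (2 * n) * pi)" by (simp add: complex_eq_iff)
      then have "norm (d y - d x) = \<bar>of_int n\<bar> * (2 * pi)" and "n \<noteq> 0"
        using y by (auto simp: norm_mult abs_mult)
      moreover have "1 \<le> \<bar>of_int n :: real\<bar>" using \<open>n \<noteq> 0\<close> by linarith
      moreover have "1 \<le> 2 * pi" using pi_gt3 by linarith
      ultimately show "1 \<le> norm (d y - d x)"
        using mult_mono[of 1 "\<bar>of_int n :: real\<bar>" 1 "2*pi"] by simp
    qed simp
  qed simp
  then have "d (2*pi) = d 0" unfolding constant_on_def by force
  then show ?thesis by (simp add: d_def algebra_simps)
qed

text \<open>Adding ln |w| as real part turns the continuous angle of the winding number into a
  complex logarithm. Periodicity of \<open>w\<close> cancels this real part in the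
  increment.\<close>

lemma has_winding_logarithm:
  assumes wind: "has_winding w j"
    and per: "w (1, 2*pi) = w (1, 0)"
    and cw: "continuous_on {0..2*pi} (\<lambda>t. w (1, t))"
  obtains k where "continuous_on {0..2*pi} k"
    and "\<And>t. t \<in> {0..2*pi} \<Longrightarrow> w (1, t) = exp (k t)"
    and "k (2*pi) - k 0 = 2 * of_real pi * \<i> * of_int j"
proof -
  obtain \<theta> where nz: "\<And>t. w (1, t) \<noteq> 0" and \<theta>: "continuous_on {0..2*pi} \<theta>"
      "\<And>t. t\<in>{0..2*pi} \<Longrightarrow> w (1, t) = of_real (norm (w (1, t))) * exp (\<i> * of_real (\<theta> t))"
      "\<theta> (2*pi) - \<theta> 0 = 2 * pi * of_int j"
    using wind unfolding has_winding_def by blast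
  define k where "k t = of_real (ln (norm (w (1, t)))) + \<i> * of_real (\<theta> t)" for t
  show thesis
  proof (rule that[of k])
    show "continuous_on {0..2*pi} k"
      unfolding k_def by (intro continuous_intros cw \<theta>(1)) (use nz in auto)
    fix t assume t: "t \<in> {0..2*pi}"
    have "exp (k t) = of_real (norm (w (1, t))) * exp (\<i> * of_real (\<theta> t))"
      unfolding k_def exp_add exp_of_real using nz by (simp add: exp_of_real[symmetric])
    then show "w (1, t) = exp (k t)" using \<theta>(2)[OF t] by simp
  next
    have "k (2*pi) - k 0 = \<i> * of_real (\<theta> (2*pi) - \<theta> 0)"
      by (simp add: k_def per right_diff_distrib)
    then show "k (2*pi) - k 0 = 2 * of_real pi * \<i> * of_int j" by (simp add: \<theta>(3))
  qed
qed

lemma has_winding_log_increment: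
  assumes wind: "has_winding w j"
    and per: "w (1, 2*pi) = w (1, 0)"
    and cw: "continuous_on {0..2*pi} (\<lambda>t. w (1, t))"
    and ch: "continuous_on {0..2*pi} h"
    and eq: "\<And>t. t \<in> {0..2*pi} \<Longrightarrow> w (1, t) = exp (h t)"
  shows "h (2*pi) - h 0 = 2 * of_real pi * \<i> * of_int j"
proof -
  obtain k where k: "continuous_on {0..2*pi} k" "\<And>t. t \<in> {0..2*pi} \<Longrightarrow> w (1, t) = exp (k t)"
    "k (2*pi) - k 0 = 2 * of_real pi * \<i> * of_int j"
    using has_winding_logarithm[OF wind per cw] by blast
  then show ?thesis using exp_eq_imp_increment_eq[OF ch k(1)] eq by metis
qed

subsection \<open>The system for the angular parts\<close>

definition separated :: "complex \<Rightarrow> (real \<Rightarrow> complex) \<Rightarrow> (real \<Rightarrow> complex) \<Rightarrow> real \<times> real \<Rightarrow> complex" where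
  "separated \<sigma> \<phi> \<psi> = (\<lambda>(r, t). rpow r \<sigma> * \<phi> t + cnj (rpow r \<sigma> * \<psi> t))"

lemma rpow_eq_exp: "0 < r \<Longrightarrow> rpow r \<sigma> = exp (\<sigma> * of_real (ln r))"
  by (simp add: rpow_def powr_def Ln_of_real)

lemma norm_rpow: "0 < r \<Longrightarrow> norm (rpow r \<sigma>) = r powr Re \<sigma>"
  by (simp add: rpow_eq_exp powr_def mult.commute)

lemma rpow_one: "rpow 1 \<sigma> = 1"
  by (simp add: rpow_def)

lemma has_vector_derivative_rpow:
  assumes "0 < r"
  shows "((\<lambda>r. rpow r \<sigma>) has_vector_derivative \<sigma> * rpow r \<sigma> / of_real r) (at r)"
proof -
  have "((\<lambda>r. exp (\<sigma> * of_real (ln r))) has_vector_derivative (\<sigma> * of_real (1 / r)) * exp (\<sigma> * of_real (ln r))) (at r)"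
  proof -
    have "((\<lambda>r. \<sigma> * of_real (ln r)) has_vector_derivative \<sigma> * of_real (1 / r)) (at r)"
      using assms
      by (intro has_vector_derivative_mult_right has_vector_derivative_of_real)
         (auto intro!: derivative_eq_intros simp flip: has_real_derivative_iff_has_vector_derivative)
    from field_vector_diff_chain_at[OF this DERIV_exp] show ?thesis
      by (simp add: o_def)
  qed
  then have "((\<lambda>r. exp (\<sigma> * of_real (ln r))) has_vector_derivative \<sigma> * rpow r \<sigma> / of_real r) (at r)"
    using assms by (simp add: rpow_eq_exp)
  then show ?thesis
    by (rule has_vector_derivative_transform_within_open[of _ _ _ "{0<..}"])
       (use assms in \<open>auto simp: rpow_eq_exp\<close>)
qed

locale spiral_operator =
  fixes lam :: complex and nu :: real and c :: "real \<Rightarrow> complex" and M :: real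
  assumes Re_pos: "0 < Re lam" and Im_nonzero: "Im lam \<noteq> 0"
    and c_cont: "continuous_on UNIV c" and c_bound: "\<And>t. norm (c t) \<le> M" and M_pos: "0 < M"
begin

lemma lam_nonzero: "lam \<noteq> 0"
  using Im_nonzero by auto

text \<open>Separating the powers \<open>r\<^sup>\<sigma>\<close> and \<open>r\<^bsup>cnj \<sigma>\<^esup>\<close> turns the equation for
  \<open>separated \<sigma> \<phi> \<psi>\<close> into this complex linear system. For real \<open>\<sigma>\<close> the two powers coincide
  and \<open>r\<^sup>\<sigma> f\<close> is represented by \<open>\<phi> = f/2\<close>, \<open>\<psi> = cnj \<phi>\<close>.\<close>

definition mode :: "complex \<Rightarrow> (real \<Rightarrow> complex) \<Rightarrow> (real \<Rightarrow> complex) \<Rightarrow> bool" where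
  "mode \<sigma> \<phi> \<psi> \<longleftrightarrow>
     (\<forall>t. \<phi> (t + 2*pi) = \<phi> t \<and> \<psi> (t + 2*pi) = \<psi> t) \<and>
     (\<forall>t. (\<phi> has_vector_derivative \<i> * (\<sigma> / lam - of_real nu) * \<phi> t + c t / lam * \<psi> t) (at t)) \<and>
     (\<forall>t. (\<psi> has_vector_derivative - \<i> * (\<sigma> / cnj lam - of_real nu) * \<psi> t + cnj (c t / lam) * \<phi> t) (at t)) \<and>
     (Im \<sigma> = 0 \<longrightarrow> (\<forall>t. \<psi> t = cnj (\<phi> t)))"

lemma modeD:
  assumes "mode \<sigma> \<phi> \<psi>"
  shows "\<phi> (t + 2*pi) = \<phi> t" "\<psi> (t + 2*pi) = \<psi> t"
    "(\<phi> has_vector_derivative \<i> * (\<sigma> / lam - of_real nu) * \<phi> t + c t / lam * \<psi> t) (at t)"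
    "(\<psi> has_vector_derivative - \<i> * (\<sigma> / cnj lam - of_real nu) * \<psi> t + cnj (c t / lam) * \<phi> t) (at t)"
    "Im \<sigma> = 0 \<Longrightarrow> \<psi> t = cnj (\<phi> t)"
  using assms unfolding mode_def by blast+

lemma mode_continuous:
  assumes "mode \<sigma> \<phi> \<psi>"
  shows "continuous_on S \<phi>" "continuous_on S \<psi>"
  using modeD(3,4)[OF assms]
  by (meson continuous_at_imp_continuous_on has_vector_derivative_continuous)+

text \<open>The coefficients are real because a nonreal factor would destroy the relation
  \<open>\<psi> = cnj \<phi>\<close> imposed for real \<open>\<sigma>\<close>.\<close>

lemma mode_combination:
  assumes "mode \<sigma> \<phi> \<psi>" "mode \<sigma> \<phi>' \<psi>'"
  shows "mode \<sigma> (\<lambda>t. of_real x * \<phi> t + of_real y * \<phi>' t) (\<lambda>t. of_real x * \<psi> t + of_real y * \<psi>' t)"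
  unfolding mode_def
proof (intro conjI allI impI)
  fix t
  show "((\<lambda>t. of_real x * \<phi> t + of_real y * \<phi>' t) has_vector_derivative
      \<i> * (\<sigma> / lam - of_real nu) * (of_real x * \<phi> t + of_real y * \<phi>' t)
      + c t / lam * (of_real x * \<psi> t + of_real y * \<psi>' t)) (at t)"
    using has_vector_derivative_add[OF
        has_vector_derivative_mult_right[OF modeD(3)[OF assms(1), of t], of "of_real x"]
        has_vector_derivative_mult_right[OF modeD(3)[OF assms(2), of t], of "of_real y"]]
    by (rule back_subst[where P = "\<lambda>d. (_ has_vector_derivative d) (at t)"]) (simp add: algebra_simps)
  show "((\<lambda>t. of_real x * \<psi> t + of_real y * \<psi>' t) has_vector_derivative
      - \<i> * (\<sigma> / cnj lam - of_real nu) * (of_real x * \<psi> t + of_real y * \<psi>' t)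
      + cnj (c t / lam) * (of_real x * \<phi> t + of_real y * \<phi>' t)) (at t)"
    using has_vector_derivative_add[OF
        has_vector_derivative_mult_right[OF modeD(4)[OF assms(1), of t], of "of_real x"]
        has_vector_derivative_mult_right[OF modeD(4)[OF assms(2), of t], of "of_real y"]]
    by (rule back_subst[where P = "\<lambda>d. (_ has_vector_derivative d) (at t)"]) (simp add: algebra_simps)
qed (use modeD(1,2,5)[OF assms(1)] modeD(1,2,5)[OF assms(2)] in auto)

lemma coefficient_bound: "norm (c t / lam) \<le> M / norm lam"
  using c_bound[of t] lam_nonzero by (simp add: norm_divide divide_right_mono)

text \<open>Uniqueness for the linear system, by Gronwall applied to |\<phi>|^2 +
  |\<psi>|^2.\<close>

lemma mode_unique:
  assumes m: "mode \<sigma> \<phi> \<psi>" and z: "\<phi> s = 0" "\<psi> s = 0"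
  shows "\<phi> t = 0 \<and> \<psi> t = 0"
proof -
  define A where "A = \<i> * (\<sigma> / lam - of_real nu)"
  define A' where "A' = - \<i> * (\<sigma> / cnj lam - of_real nu)"
  define g where "g t = (norm (\<phi> t))\<^sup>2 + (norm (\<psi> t))\<^sup>2" for t
  define g' where "g' t = 2 * Re (cnj (\<phi> t) * (A * \<phi> t + c t / lam * \<psi> t))
    + 2 * Re (cnj (\<psi> t) * (A' * \<psi> t + cnj (c t / lam) * \<phi> t))" for t
  \<comment> \<open>The two coupling terms together contribute at most 4 (M/|lam|) |\<phi>|
    |\<psi>|, and 2 |\<phi>| |\<psi>| is at most \<open>g\<close>.\<close>
  define C where "C = 2 * norm A + 2 * norm A' + 2 * (M / norm lam)"
  have der: "(g has_real_derivative g' t) (at t)" for t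
    unfolding g_def g'_def A_def A'_def
    by (intro DERIV_add has_real_derivative_norm_squared modeD(3,4)[OF m])
  have bd: "\<bar>g' t\<bar> \<le> C * g t" for t
  proof -
    define x y where "x = norm (\<phi> t)" and "y = norm (\<psi> t)"
    have xy: "0 \<le> x" "0 \<le> y" "2 * (x * y) \<le> x\<^sup>2 + y\<^sup>2"
      using sum_squares_bound[of x y] by (simp_all add: x_def y_def)
    have X: "norm (c t / lam) \<le> M / norm lam" by (rule coefficient_bound)
    have "\<bar>Re (cnj (\<phi> t) * (A * \<phi> t + c t / lam * \<psi> t))\<bar> \<le> x * (norm A * x + norm (c t / lam) * y)"
      unfolding x_def y_def
      by (rule order_trans[OF abs_Re_le_cmod], subst norm_mult, subst complex_mod_cnj,
          intro mult_left_mono norm_triangle_le add_mono) (simp_all add: norm_mult norm_divide)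
    moreover have "x * (norm A * x + norm (c t / lam) * y) \<le> x * (norm A * x + M / norm lam * y)"
      using X xy by (intro mult_left_mono add_mono mult_right_mono) auto
    moreover have "\<bar>Re (cnj (\<psi> t) * (A' * \<psi> t + cnj (c t / lam) * \<phi> t))\<bar> \<le> y * (norm A' * y + norm (c t / lam) * x)"
      unfolding x_def y_def
      by (rule order_trans[OF abs_Re_le_cmod], subst norm_mult, subst complex_mod_cnj,
          intro mult_left_mono norm_triangle_le add_mono) (simp_all add: norm_mult norm_divide)
    moreover have "y * (norm A' * y + norm (c t / lam) * x) \<le> y * (norm A' * y + M / norm lam * x)"
      using X xy by (intro mult_left_mono add_mono mult_right_mono) auto
    ultimately have "\<bar>g' t\<bar> \<le> 2 * (x * (norm A * x + M / norm lam * y)) + 2 * (y * (norm A' * y + M / norm lam * x))"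
      unfolding g'_def by linarith
    also have "\<dots> = 2 * norm A * x\<^sup>2 + 2 * norm A' * y\<^sup>2 + 2 * (M / norm lam) * (2 * (x * y))"
      by (simp add: power2_eq_square algebra_simps)
    also have "\<dots> \<le> 2 * norm A * (x\<^sup>2 + y\<^sup>2) + 2 * norm A' * (x\<^sup>2 + y\<^sup>2) + 2 * (M / norm lam) * (x\<^sup>2 + y\<^sup>2)"
      using xy M_pos by (intro add_mono mult_left_mono) auto
    also have "\<dots> = C * g t"
      by (simp add: C_def g_def x_def y_def algebra_simps)
    finally show ?thesis .
  qed
  have "g t \<le> g s * exp (C * \<bar>t - s\<bar>)"
    by (rule gronwall_two_sided[OF der bd])
  also have "g s = 0" using z by (simp add: g_def)
  finally have "g t = 0" by (simp add: g_def sum_power2_le_zero_iff)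
  then show ?thesis by (simp add: g_def sum_power2_eq_zero_iff)
qed

text \<open>With \<open>d = |\<phi>|\<^sup>2 - |\<psi>|\<^sup>2\<close> and \<open>\<kappa>\<close> as below, \<open>d(t) exp(-\<kappa> t)\<close> is strictly monotone in the
  direction opposite to \<open>Im \<sigma>\<close>; periodicity of \<open>d\<close> then fixes the sign of \<open>d\<close> everywhere.\<close>

lemma mode_modulus_sign:
  assumes m: "mode \<sigma> \<phi> \<psi>" and nonreal: "Im \<sigma> \<noteq> 0" and nt: "\<phi> s \<noteq> 0 \<or> \<psi> s \<noteq> 0"
  shows "0 < Im \<sigma> * (1 - exp (- (2 * pi * (2 * Re \<sigma> * Im lam / (norm lam)\<^sup>2))))
               * ((norm (\<phi> t))\<^sup>2 - (norm (\<psi> t))\<^sup>2)"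
proof -
  \<comment> \<open>\<open>Im (\<sigma> / lam)\<close> and \<open>Im (\<sigma> / cnj lam)\<close>
    are half the difference and half the sum of \<open>\<eta>\<close> and
    \<open>\<kappa>\<close>.\<close>
  define \<kappa> where "\<kappa> = 2 * Re \<sigma> * Im lam / (norm lam)\<^sup>2"
  define \<eta> where "\<eta> = 2 * Im \<sigma> * Re lam / (norm lam)\<^sup>2"
  define d where "d t = (norm (\<phi> t))\<^sup>2 - (norm (\<psi> t))\<^sup>2" for t
  define G where "G t = d t * exp (- \<kappa> * t)" for t
  define e where "e t = (norm (\<phi> t))\<^sup>2 + (norm (\<psi> t))\<^sup>2" for t
  have e_pos: "0 < e t" for t
  proof -
    have "\<phi> t \<noteq> 0 \<or> \<psi> t \<noteq> 0" using mode_unique[OF m, of t s] nt by blast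
    then show ?thesis by (auto simp: e_def sum_power2_gt_zero_iff)
  qed
  have der_d: "(d has_real_derivative \<kappa> * d t - \<eta> * e t) (at t)" for t
  proof -
    let ?X = "c t / lam"
    let ?P = "\<i> * (\<sigma> / lam - of_real nu) * \<phi> t + ?X * \<psi> t"
    let ?Q = "- \<i> * (\<sigma> / cnj lam - of_real nu) * \<psi> t + cnj ?X * \<phi> t"
    have "(d has_real_derivative 2 * Re (cnj (\<phi> t) * ?P) - 2 * Re (cnj (\<psi> t) * ?Q)) (at t)"
      unfolding d_def by (intro DERIV_diff has_real_derivative_norm_squared modeD(3,4)[OF m])
    moreover have "2 * Re (cnj (\<phi> t) * ?P) - 2 * Re (cnj (\<psi> t) * ?Q) = \<kappa> * d t - \<eta> * e t"
    proof -
      have P: "Re (cnj z * (\<i> * (S - of_real nu) * z + v)) = - Im S * (norm z)\<^sup>2 + Re (cnj z * v)" for z S v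
        by (simp add: cmod_power2) (simp add: power2_eq_square algebra_simps)
      have Q: "Re (cnj z * (- \<i> * (S - of_real nu) * z + v)) = Im S * (norm z)\<^sup>2 + Re (cnj z * v)" for z S v
        by (simp add: cmod_power2) (simp add: power2_eq_square algebra_simps)
      \<comment> \<open>\<open>c\<close> enters the two equations with mutually conjugate
        coefficients, so its contributions to the derivative of \<open>d\<close> cancel.\<close>
      have X: "Re (cnj (\<phi> t) * (X * \<psi> t)) = Re (cnj (\<psi> t) * (cnj X * \<phi> t))" for X
        by (simp add: algebra_simps)
      have I1: "Im (\<sigma> / lam) = (\<eta> - \<kappa>) / 2" and I2: "Im (\<sigma> / cnj lam) = (\<eta> + \<kappa>) / 2"
        by (simp_all add: \<eta>_def \<kappa>_def Im_divide add_divide_distrib diff_divide_distrib flip: cmod_power2)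
      show ?thesis
        unfolding P Q X I1 I2 d_def e_def by (simp add: field_simps)
    qed
    ultimately show ?thesis by simp
  qed
  have der_G: "(G has_real_derivative - \<eta> * e t * exp (- \<kappa> * t)) (at t)" for t
    unfolding G_def by (rule derivative_eq_intros der_d refl | simp add: algebra_simps)+
  \<comment> \<open>The mean value theorem over a full period compares \<open>G\<close> at two
    points where \<open>d\<close> agrees, so only the exponential factors differ.\<close>
  have "t < t + 2*pi" by simp
  from MVT2[OF this der_G] obtain z
    where "G (t + 2*pi) - G t = (t + 2*pi - t) * (- \<eta> * e z * exp (- \<kappa> * z))"
    by blast
  then have "G t - G (t + 2*pi) = 2*pi * \<eta> * e z * exp (- \<kappa> * z)"
    by (simp add: algebra_simps)
  then have "Im \<sigma> * (G t - G (t + 2*pi)) = 2*pi * (Im \<sigma> * \<eta>) * e z * exp (- \<kappa> * z)"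
    by (simp only: mult_ac)
  moreover have "0 < Im \<sigma> * \<eta>"
  proof -
    have "Im \<sigma> * \<eta> = 2 * (Im \<sigma>)\<^sup>2 * Re lam / (norm lam)\<^sup>2"
      by (simp add: \<eta>_def power2_eq_square)
    then show ?thesis using nonreal Re_pos lam_nonzero by simp
  qed
  ultimately have "0 < Im \<sigma> * (G t - G (t + 2*pi))"
    using e_pos[of z] by (metis exp_gt_zero mult_pos_pos pi_gt_zero zero_less_numeral)
  also have "G t - G (t + 2*pi) = (1 - exp (- (2 * pi * \<kappa>))) * d t * exp (- \<kappa> * t)"
  proof -
    have "d (t + 2*pi) = d t" by (simp add: d_def modeD(1,2)[OF m])
    moreover have "exp (- \<kappa> * (t + 2*pi)) = exp (- \<kappa> * t) * exp (- (2 * pi * \<kappa>))"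
      by (simp add: algebra_simps flip: exp_add)
    ultimately show ?thesis by (simp add: G_def algebra_simps)
  qed
  finally have "0 < (Im \<sigma> * (1 - exp (- (2 * pi * \<kappa>))) * d t) * exp (- \<kappa> * t)"
    by (simp add: mult.assoc)
  then have "0 < Im \<sigma> * (1 - exp (- (2 * pi * \<kappa>))) * d t"
    by (simp only: zero_less_mult_iff exp_gt_zero) auto
  then show ?thesis by (simp add: d_def \<kappa>_def)
qed

end

section \<open>Angular parts of a basic solution\<close>

lemma has_derivative_partials:
  fixes w :: "real \<times> real \<Rightarrow> complex"
  assumes "(w has_derivative D) (at (r, t))"
  shows "((\<lambda>s. w (r, s)) has_vector_derivative D (0, 1)) (at t)"
    and "((\<lambda>s. w (s, t)) has_vector_derivative D (1, 0)) (at r)"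
proof -
  have lin: "linear D" using assms has_derivative_linear by blast
  have *: "((\<lambda>s. (r, s)) has_derivative (\<lambda>h. (0, h))) (at t)"
       "((\<lambda>s. (s, t)) has_derivative (\<lambda>h. (h, 0))) (at r)"
    by (auto intro!: derivative_eq_intros)
  have scale: "D (0, h) = h *\<^sub>R D (0, 1)" "D (h, 0) = h *\<^sub>R D (1, 0)" for h
    using linear_scale[OF lin, of h "(0, 1)"] linear_scale[OF lin, of h "(1, 0)"] by simp_all
  have "(\<lambda>h. D (0, h)) = (\<lambda>h. h *\<^sub>R D (0, 1))" "(\<lambda>h. D (h, 0)) = (\<lambda>h. h *\<^sub>R D (1, 0))"
    by (rule ext, rule scale)+
  with diff_chain_at[OF *(1), of w D] diff_chain_at[OF *(2), of w D] assms
  show "((\<lambda>s. w (r, s)) has_vector_derivative D (0, 1)) (at t)"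
    "((\<lambda>s. w (s, t)) has_vector_derivative D (1, 0)) (at r)"
    by (simp_all only: has_vector_derivative_def o_def)
qed

context spiral_operator begin

text \<open>A basic solution comes without any regularity of \<open>\<phi>\<close> and
  \<open>\<psi>\<close>. For nonreal \<open>\<sigma>\<close> they can be recovered from
  \<open>w\<close> at two radii and inherit its derivatives and equation. For real
  \<open>\<sigma>\<close> only \<open>\<phi> + cnj \<psi>\<close> is determined by \<open>w\<close>;
  it is divided evenly between the two parts.\<close>

lemma basic_solution_mode:
  assumes bs: "basic_solution lam nu c w \<sigma>"
  obtains \<phi> \<psi> where "mode \<sigma> \<phi> \<psi>"
    and "\<And>r t. 0 < r \<Longrightarrow> w (r, t) = separated \<sigma> \<phi> \<psi> (r, t)"
    and "\<exists>t. \<phi> t \<noteq> 0 \<or> \<psi> t \<noteq> 0"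
    and "\<And>t. Im \<sigma> \<noteq> 0 \<Longrightarrow> norm (\<psi> t) < norm (\<phi> t)"
proof -
  obtain \<phi> \<psi> where *: "\<forall>t. \<phi> (t + 2*pi) = \<phi> t \<and> \<psi> (t + 2*pi) = \<psi> t"
    "\<forall>r t. 0 < r \<longrightarrow> w (r, t) = rpow r \<sigma> * \<phi> t + cnj (rpow r \<sigma> * \<psi> t)"
    and dom: "\<sigma> \<in> \<real> \<or> (\<forall>t. norm (\<psi> t) < norm (\<phi> t))"
    using bs unfolding basic_solution_def by blast
  from * have per: "\<phi> (t + 2*pi) = \<phi> t" "\<psi> (t + 2*pi) = \<psi> t"
    and w: "0 < r \<Longrightarrow> w (r, t) = rpow r \<sigma> * \<phi> t + cnj (rpow r \<sigma> * \<psi> t)" for r t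
    by blast+
  have sol: "L_solution lam nu c {0<..} w" and nt: "\<exists>r t. 0 < r \<and> w (r, t) \<noteq> 0"
    using bs unfolding basic_solution_def by blast+
  \<comment> \<open>The radial derivative is explicit in the separated form, so the equation becomes
    a formula for the angular derivative \<open>T\<close>.\<close>
  define T where "T r t = vector_derivative (\<lambda>s. w (r, s)) (at t)" for r t
  have T: "((\<lambda>s. w (r, s)) has_vector_derivative T r t) (at t)"
    and eq: "lam * T r t - \<i> * (\<sigma> * rpow r \<sigma> * \<phi> t + cnj (\<sigma> * rpow r \<sigma> * \<psi> t))
       + \<i> * lam * of_real nu * w (r, t) - c t * cnj (w (r, t)) = 0" if r: "0 < r" for r t
  proof -
    obtain D where D: "(w has_derivative D) (at (r, t))"
      "lam * D (0, 1) - \<i> * of_real r * D (1, 0) + \<i> * lam * of_real nu * w (r, t)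
          - c t * cnj (w (r, t)) = 0"
      using sol r unfolding L_solution_def greaterThan_iff[symmetric] by blast
    note d = has_derivative_partials[OF D(1)]
    have TD: "T r t = D (0, 1)"
      unfolding T_def by (rule vector_derivative_at[OF d(1)])
    have "((\<lambda>r. rpow r \<sigma> * \<phi> t + cnj (rpow r \<sigma> * \<psi> t)) has_vector_derivative
        \<sigma> * rpow r \<sigma> / of_real r * \<phi> t + cnj (\<sigma> * rpow r \<sigma> / of_real r * \<psi> t)) (at r)"
      by (intro has_vector_derivative_add has_vector_derivative_cnj has_vector_derivative_mult_left
          has_vector_derivative_rpow r)
    then have "((\<lambda>r. w (r, t)) has_vector_derivative
        \<sigma> * rpow r \<sigma> / of_real r * \<phi> t + cnj (\<sigma> * rpow r \<sigma> / of_real r * \<psi> t)) (at r)"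
      by (rule has_vector_derivative_transform_within_open[of _ _ _ "{0<..}"])
         (use r w in auto)
    then have "D (1, 0) = \<sigma> * rpow r \<sigma> / of_real r * \<phi> t + cnj (\<sigma> * rpow r \<sigma> / of_real r * \<psi> t)"
      using d(2) vector_derivative_unique_at by blast
    then have "of_real r * D (1, 0) = \<sigma> * rpow r \<sigma> * \<phi> t + cnj (\<sigma> * rpow r \<sigma> * \<psi> t)"
      using r by (simp add: distrib_left)
    then show "lam * T r t - \<i> * (\<sigma> * rpow r \<sigma> * \<phi> t + cnj (\<sigma> * rpow r \<sigma> * \<psi> t))
       + \<i> * lam * of_real nu * w (r, t) - c t * cnj (w (r, t)) = 0"
      using D(2) unfolding TD by (simp add: mult.assoc)
    show "((\<lambda>s. w (r, s)) has_vector_derivative T r t) (at t)" using d(1) TD by simp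
  qed
  show thesis
  proof (cases "Im \<sigma> = 0")
    case True
    then have \<sigma>: "cnj \<sigma> = \<sigma>" by (simp add: complex_eq_iff)
    have rp: "cnj (rpow r \<sigma>) = rpow r \<sigma>" if "0 < r" for r
      using that by (simp add: rpow_eq_exp exp_cnj \<sigma>)
    define f where "f t = w (1, t)" for t
    have f: "f t = \<phi> t + cnj (\<psi> t)" for t by (simp add: f_def w rpow_one)
    have T1: "T 1 t = \<i> * (\<sigma> / lam - of_real nu) * f t + c t / lam * cnj (f t)" for t
    proof -
      have "lam * T 1 t = \<i> * \<sigma> * f t - \<i> * lam * of_real nu * f t + c t * cnj (f t)"
        using eq[of 1 t] by (simp add: rpow_one f w \<sigma> algebra_simps)
      then have "T 1 t = (\<i> * \<sigma> * f t - \<i> * lam * of_real nu * f t + c t * cnj (f t)) / lam"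
        using lam_nonzero by (simp add: eq_divide_eq mult.commute)
      then show ?thesis
        using lam_nonzero by (simp add: add_divide_distrib diff_divide_distrib algebra_simps)
    qed
    have df: "(f has_vector_derivative T 1 t) (at t)" for t
      using T[of 1 t] by (simp add: f_def[abs_def])
    show thesis
    proof (rule that[of "\<lambda>t. f t / 2" "\<lambda>t. cnj (f t) / 2"])
      show "mode \<sigma> (\<lambda>t. f t / 2) (\<lambda>t. cnj (f t) / 2)"
        unfolding mode_def
      proof (intro conjI allI impI)
        fix t
        show "((\<lambda>t. f t / 2) has_vector_derivative
            \<i> * (\<sigma> / lam - of_real nu) * (f t / 2) + c t / lam * (cnj (f t) / 2)) (at t)"
          using has_vector_derivative_divide[OF df[of t], of 2] by (simp add: T1 add_divide_distrib)
        show "((\<lambda>t. cnj (f t) / 2) has_vector_derivative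
            - \<i> * (\<sigma> / cnj lam - of_real nu) * (cnj (f t) / 2) + cnj (c t / lam) * (f t / 2)) (at t)"
          using has_vector_derivative_divide[OF has_vector_derivative_cnj[OF df[of t]], of 2]
          by (simp add: T1 \<sigma> add_divide_distrib diff_divide_distrib)
      qed (simp_all add: f per)
      show "w (r, t) = separated \<sigma> (\<lambda>t. f t / 2) (\<lambda>t. cnj (f t) / 2) (r, t)" if "0 < r" for r t
        using that by (simp add: separated_def f w rp algebra_simps add_divide_distrib)
      show "\<exists>t. f t / 2 \<noteq> 0 \<or> cnj (f t) / 2 \<noteq> 0"
      proof -
        obtain r t where "0 < r" "w (r, t) \<noteq> 0" using nt by blast
        then have "f t \<noteq> 0" by (auto simp: w rp f simp flip: distrib_left)
        then show ?thesis by auto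
      qed
    qed (use True in simp)
  next
    case False
    then have dom': "norm (\<psi> t) < norm (\<phi> t)" for t
      using dom by (auto simp: complex_is_Real_iff)
    \<comment> \<open>With \<open>Im \<sigma> * ln r1 = pi / 2\<close> the number r1^\<sigma> is a
      nonzero imaginary number, hence differs from its conjugate.\<close>
    define r1 where "r1 = exp (pi / (2 * Im \<sigma>))"
    define z where "z = rpow r1 \<sigma>"
    have r1: "0 < r1" by (simp add: r1_def)
    have "Im z \<noteq> 0"
      using False by (simp add: z_def r1_def rpow_eq_exp Im_exp)
    then have z: "z - cnj z \<noteq> 0" by (simp add: complex_eq_iff)
    have w1: "w (1, t) = \<phi> t + cnj (\<psi> t)" and wr: "w (r1, t) = z * \<phi> t + cnj (z * \<psi> t)" for t
      using w[of 1 t] w[OF r1, of t] by (simp_all add: rpow_one z_def)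
    \<comment> \<open>\<open>d\<close> and \<open>e\<close> are the derivatives of
      \<open>\<phi>\<close> and \<open>cnj \<psi>\<close>, found by solving the 2x2 system given by
      \<open>w\<close> at the radii 1 and \<open>r1\<close>.\<close>
    define d where "d t = (T r1 t - cnj z * T 1 t) / (z - cnj z)" for t
    define e where "e t = T 1 t - d t" for t
    have \<phi>: "\<phi> = (\<lambda>t. (w (r1, t) - cnj z * w (1, t)) / (z - cnj z))"
      using z by (intro ext) (simp add: w1 wr eq_divide_eq algebra_simps)
    have \<psi>: "\<psi> = (\<lambda>t. cnj (w (1, t) - \<phi> t))"
      by (intro ext) (simp add: w1)
    have d\<phi>: "(\<phi> has_vector_derivative d t) (at t)" for t
      unfolding d_def
      by (subst \<phi>, intro has_vector_derivative_divide has_vector_derivative_diff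
          has_vector_derivative_mult_right T r1) simp
    have d\<psi>: "(\<psi> has_vector_derivative cnj (e t)) (at t)" for t
      unfolding e_def
      by (subst \<psi>, intro has_vector_derivative_cnj has_vector_derivative_diff T d\<phi>) simp
    \<comment> \<open>\<open>E1\<close> and \<open>E2\<close> are the factors of r^\<sigma> and of
      its conjugate in the equation. The radii 1 and \<open>r1\<close> give
      \<open>E1 + E2 = 0\<close> and \<open>z * E1 + cnj z * E2 = 0\<close>, which has only the zero
      solution.\<close>
    define E1 where "E1 t = lam * d t - \<i> * \<sigma> * \<phi> t + \<i> * lam * of_real nu * \<phi> t - c t * \<psi> t" for t
    define E2 where "E2 t = lam * e t - \<i> * cnj (\<sigma> * \<psi> t) + \<i> * lam * of_real nu * cnj (\<psi> t)
      - c t * cnj (\<phi> t)" for t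
    have T1: "T 1 t = d t + e t" and Tr: "T r1 t = z * d t + cnj z * e t" for t
    proof -
      show "T 1 t = d t + e t" by (simp add: e_def)
      have "(z - cnj z) * d t = T r1 t - cnj z * T 1 t" using z by (simp add: d_def)
      then show "T r1 t = z * d t + cnj z * e t" by (simp add: e_def algebra_simps)
    qed
    have E: "E1 t = 0" "E2 t = 0" for t
    proof -
      have a: "E1 t + E2 t = 0"
        using eq[of 1 t] by (simp add: E1_def E2_def T1 w1 rpow_one algebra_simps)
      have "z * E1 t + cnj z * E2 t = 0"
        using eq[OF r1, of t] by (simp add: E1_def E2_def Tr wr algebra_simps flip: z_def)
      moreover have "E2 t = - E1 t" using a by (simp add: add_eq_0_iff)
      ultimately have "(z - cnj z) * E1 t = 0" by (simp add: algebra_simps)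
      then show "E1 t = 0" using z by simp
      then show "E2 t = 0" using a by simp
    qed
    show thesis
    proof (rule that[of \<phi> \<psi>])
      have d: "d t = \<i> * (\<sigma> / lam - of_real nu) * \<phi> t + c t / lam * \<psi> t" for t
      proof -
        have "d t * lam = \<i> * \<sigma> * \<phi> t - \<i> * lam * of_real nu * \<phi> t + c t * \<psi> t"
          using E(1)[of t] by (simp add: E1_def algebra_simps)
        then have "d t = (\<i> * \<sigma> * \<phi> t - \<i> * lam * of_real nu * \<phi> t + c t * \<psi> t) / lam"
          using lam_nonzero by (simp add: eq_divide_eq)
        then show ?thesis
          using lam_nonzero by (simp add: add_divide_distrib diff_divide_distrib algebra_simps)
      qed
      have e: "e t = \<i> * (cnj \<sigma> / lam - of_real nu) * cnj (\<psi> t) + c t / lam * cnj (\<phi> t)" for t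
      proof -
        have "e t * lam = \<i> * cnj \<sigma> * cnj (\<psi> t) - \<i> * lam * of_real nu * cnj (\<psi> t) + c t * cnj (\<phi> t)"
          using E(2)[of t] by (simp add: E2_def algebra_simps)
        then have "e t = (\<i> * cnj \<sigma> * cnj (\<psi> t) - \<i> * lam * of_real nu * cnj (\<psi> t) + c t * cnj (\<phi> t)) / lam"
          using lam_nonzero by (simp add: eq_divide_eq)
        then show ?thesis
          using lam_nonzero by (simp add: add_divide_distrib diff_divide_distrib algebra_simps)
      qed
      have "cnj (e t) = - \<i> * (\<sigma> / cnj lam - of_real nu) * \<psi> t + cnj (c t / lam) * \<phi> t" for t
        by (simp add: e)
      then show "mode \<sigma> \<phi> \<psi>"
        unfolding mode_def using per d\<phi> d\<psi> d False by simp
      show "w (r, t) = separated \<sigma> \<phi> \<psi> (r, t)" if "0 < r" for r t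
        using w[OF that] by (simp add: separated_def)
      show "\<exists>t. \<phi> t \<noteq> 0 \<or> \<psi> t \<noteq> 0" using dom' by (metis norm_zero norm_ge_zero not_less)
    qed (use dom' in auto)
  qed
qed

end

subsection \<open>Nonvanishing of modes\<close>

lemma norm_increment_bound:
  fixes f :: "real \<Rightarrow> complex"
  assumes der: "\<And>x. x \<in> {a..b} \<Longrightarrow> (f has_vector_derivative f' x) (at x within {a..b})"
    and bd: "\<And>x. x \<in> {a..b} \<Longrightarrow> norm (f' x) \<le> B"
    and x: "x \<in> {a..b}" and y: "y \<in> {a..b}"
  shows "norm (f x - f y) \<le> B * \<bar>x - y\<bar>"
proof -
  have B: "0 \<le> B" using bd[OF x] norm_ge_zero order_trans by blast
  have "norm (f x - f y) \<le> B * norm (x - y)"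
  proof (rule differentiable_bound[OF _ _ _ x y])
    show "(f has_derivative (\<lambda>h. h *\<^sub>R f' z)) (at z within {a..b})" if "z \<in> {a..b}" for z
      using der[OF that] by (simp add: has_vector_derivative_def)
    show "onorm (\<lambda>h. h *\<^sub>R f' z) \<le> B" if "z \<in> {a..b}" for z
      by (rule onorm_bound[OF B]) (use bd[OF that] in \<open>simp add: mult.commute[of B] mult_left_mono\<close>)
  qed simp
  then show ?thesis by simp
qed

section \<open>Bounds for separated functions\<close>

lemma separated_combination:
  "separated \<sigma> (\<lambda>t. of_real x * \<phi> t + of_real y * \<phi>' t) (\<lambda>t. of_real x * \<psi> t + of_real y * \<psi>' t) p
     = of_real x * separated \<sigma> \<phi> \<psi> p + of_real y * separated \<sigma> \<phi>' \<psi>' p"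
  by (cases p) (simp add: separated_def algebra_simps)

lemma norm_separated_le:
  assumes "0 < r"
  shows "norm (separated \<sigma> \<phi> \<psi> (r, t)) \<le> r powr Re \<sigma> * (norm (\<phi> t) + norm (\<psi> t))"
  using norm_triangle_ineq[of "rpow r \<sigma> * \<phi> t" "cnj (rpow r \<sigma> * \<psi> t)"] norm_rpow[OF assms]
  by (simp add: separated_def norm_mult distrib_left del: complex_cnj_mult)

lemma norm_separated_ge:
  assumes "0 < r"
  shows "r powr Re \<sigma> * (norm (\<phi> t) - norm (\<psi> t)) \<le> norm (separated \<sigma> \<phi> \<psi> (r, t))"
  using norm_diff_ineq[of "rpow r \<sigma> * \<phi> t" "cnj (rpow r \<sigma> * \<psi> t)"] norm_rpow[OF assms]
  by (simp add: separated_def norm_mult right_diff_distrib del: complex_cnj_mult)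

context spiral_operator begin

text \<open>The sign found in \<open>mode_modulus_sign\<close> depends on \<open>\<sigma>\<close>
  alone. Membership in the spectrum supplies one basic solution with |\<phi>| > |\<psi>|, which
  fixes this sign for every nontrivial mode. A zero of \<open>\<phi>\<close> would then also be a
  zero of \<open>\<psi>\<close>, contrary to uniqueness.\<close>

lemma mode_dominated:
  assumes \<sigma>: "\<sigma> \<in> Spec lam nu c" and m: "mode \<sigma> \<phi> \<psi>" and nt: "\<phi> s \<noteq> 0 \<or> \<psi> s \<noteq> 0"
  shows "Im \<sigma> \<noteq> 0 \<Longrightarrow> norm (\<psi> t) < norm (\<phi> t)" and "norm (\<psi> t) \<le> norm (\<phi> t)" and "\<phi> t \<noteq> 0"
proof -
  show less: "norm (\<psi> t) < norm (\<phi> t)" if im: "Im \<sigma> \<noteq> 0"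
  proof -
    obtain w where "basic_solution lam nu c w \<sigma>" using \<sigma> by (auto simp: Spec_def)
    then obtain \<phi>' \<psi>' where m': "mode \<sigma> \<phi>' \<psi>'" and dom: "\<And>t. norm (\<psi>' t) < norm (\<phi>' t)"
      using basic_solution_mode im by metis
    define q where "q = Im \<sigma> * (1 - exp (- (2 * pi * (2 * Re \<sigma> * Im lam / (norm lam)\<^sup>2))))"
    have "\<phi>' 0 \<noteq> 0 \<or> \<psi>' 0 \<noteq> 0" using dom[of 0] by auto
    from mode_modulus_sign[OF m' im this, of 0]
    have "0 < q * ((norm (\<phi>' 0))\<^sup>2 - (norm (\<psi>' 0))\<^sup>2)" by (simp add: q_def)
    moreover have "0 < (norm (\<phi>' 0))\<^sup>2 - (norm (\<psi>' 0))\<^sup>2"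
      using dom[of 0] by (simp add: power_strict_mono)
    ultimately have "0 < q" using zero_less_mult_pos2 by blast
    moreover have "0 < q * ((norm (\<phi> t))\<^sup>2 - (norm (\<psi> t))\<^sup>2)"
      using mode_modulus_sign[OF m im nt, of t] by (simp add: q_def)
    ultimately have "0 < (norm (\<phi> t))\<^sup>2 - (norm (\<psi> t))\<^sup>2" using zero_less_mult_pos by blast
    then show ?thesis by (simp add: power2_less_imp_less)
  qed
  show "norm (\<psi> t) \<le> norm (\<phi> t)"
    using less modeD(5)[OF m] by (cases "Im \<sigma> = 0") auto
  then show "\<phi> t \<noteq> 0" using mode_unique[OF m, of t s] nt by auto
qed

text \<open>Stated for arbitrary nontrivial modes, so that it covers real combinations of basic
  solutions with a common exponent.\<close>

lemma separated_lower_bound: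
  assumes \<sigma>: "\<sigma> \<in> Spec lam nu c" and m: "mode \<sigma> \<phi> \<psi>" and nt: "\<phi> s \<noteq> 0 \<or> \<psi> s \<noteq> 0"
  shows "\<exists>C>0. \<forall>r t. 0 < r \<longrightarrow> C * r powr Re \<sigma> \<le> norm (separated \<sigma> \<phi> \<psi> (r, t))"
proof -
  \<comment> \<open>For real \<open>\<sigma>\<close> the difference of the moduli vanishes, but then
    the two summands of the separated function are equal and add up, so |\<phi>| serves as the
    bound.\<close>
  define g where "g t = (if Im \<sigma> = 0 then norm (\<phi> t) else norm (\<phi> t) - norm (\<psi> t))" for t
  have "continuous_on UNIV (\<lambda>t. - g t)"
    unfolding g_def by (cases "Im \<sigma> = 0") (auto intro!: continuous_intros mode_continuous[OF m])
  moreover have "g (t + 2*pi) = g t" for t by (simp add: g_def modeD(1,2)[OF m])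
  ultimately obtain s where s: "\<And>t. g s \<le> g t"
    using periodic_attains_max[of "\<lambda>t. - g t"] by auto
  have pos: "0 < g s"
    using mode_dominated(1,3)[OF \<sigma> m nt, of s] by (simp add: g_def)
  have low: "g t * r powr Re \<sigma> \<le> norm (separated \<sigma> \<phi> \<psi> (r, t))" if r: "0 < r" for r t
  proof (cases "Im \<sigma> = 0")
    case True
    then have "cnj \<sigma> = \<sigma>" by (simp add: complex_eq_iff)
    then have "cnj (rpow r \<sigma>) = rpow r \<sigma>"
      using r by (simp add: rpow_eq_exp exp_cnj)
    then have "separated \<sigma> \<phi> \<psi> (r, t) = 2 * (rpow r \<sigma> * \<phi> t)"
      using modeD(5)[OF m True] by (simp add: separated_def)
    then show ?thesis using True norm_rpow[OF r] by (simp add: g_def norm_mult mult.commute)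
  next
    case False
    then show ?thesis using norm_separated_ge[OF r] by (simp add: g_def mult.commute)
  qed
  show ?thesis
  proof (intro exI[of _ "g s"] conjI allI impI pos)
    fix r t :: real assume r: "0 < r"
    have "g s * r powr Re \<sigma> \<le> g t * r powr Re \<sigma>" by (intro mult_right_mono s) simp
    then show "g s * r powr Re \<sigma> \<le> norm (separated \<sigma> \<phi> \<psi> (r, t))" using low[OF r] order_trans by blast
  qed
qed

lemma separated_upper_bound:
  assumes m: "mode \<sigma> \<phi> \<psi>"
  shows "\<exists>C\<ge>0. \<forall>r t. 0 < r \<longrightarrow> norm (separated \<sigma> \<phi> \<psi> (r, t)) \<le> C * r powr Re \<sigma>"
proof -
  define g where "g t = norm (\<phi> t) + norm (\<psi> t)" for t
  have "continuous_on UNIV g"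
    unfolding g_def by (auto intro!: continuous_intros mode_continuous[OF m])
  then obtain s where s: "\<And>t. g t \<le> g s"
    using periodic_attains_max[of g] by (auto simp: g_def modeD(1,2)[OF m])
  show ?thesis
  proof (intro exI[of _ "g s"] conjI allI impI)
    fix r t :: real assume r: "0 < r"
    have "r powr Re \<sigma> * g t \<le> r powr Re \<sigma> * g s" by (intro mult_left_mono s) simp
    then show "norm (separated \<sigma> \<phi> \<psi> (r, t)) \<le> g s * r powr Re \<sigma>"
      using norm_separated_le[OF r, of \<sigma> \<phi> \<psi> t] by (simp add: g_def mult.commute)
  qed (simp add: g_def)
qed

section \<open>Logarithms of modes and their increments over the circle\<close>

lemma mode_logarithm:
  assumes m: "mode \<sigma> \<phi> \<psi>" and nz: "\<And>t. \<phi> t \<noteq> 0"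
  obtains H where
    "\<And>t. t \<in> {0..2*pi} \<Longrightarrow> (H has_vector_derivative \<i> * (\<sigma> / lam - of_real nu) + c t / lam * (\<psi> t / \<phi> t))
        (at t within {0..2*pi})"
    "\<And>t. t \<in> {0..2*pi} \<Longrightarrow> \<phi> t = exp (H t)"
proof -
  define F where "F t = \<i> * (\<sigma> / lam - of_real nu) + c t / lam * (\<psi> t / \<phi> t)" for t
  \<comment> \<open>\<open>F\<close> is the logarithmic derivative of \<open>\<phi>\<close>, so
    \<open>\<phi> * exp (- H)\<close> has derivative zero and keeps its initial value 1.\<close>
  define H where "H t = integral {0..t} F + Ln (\<phi> 0)" for t
  have "continuous_on {0..2*pi} F"
    unfolding F_def
    by (intro continuous_intros mode_continuous[OF m] continuous_on_subset[OF c_cont]) (use nz lam_nonzero in auto)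
  then have dH: "(H has_vector_derivative F t) (at t within {0..2*pi})" if "t \<in> {0..2*pi}" for t
    unfolding H_def using has_vector_derivative_add[OF integral_has_vector_derivative[of 0 "2*pi" F t] has_vector_derivative_const] that
    by simp
  have exp: "\<phi> t = exp (H t)" if t: "t \<in> {0..2*pi}" for t
  proof -
    have "((\<lambda>t. \<phi> t * exp (- H t)) has_vector_derivative 0) (at x within {0..2*pi})" if x: "x \<in> {0..2*pi}" for x
    proof -
      have d: "(\<phi> has_vector_derivative F x * \<phi> x) (at x within {0..2*pi})"
        using has_vector_derivative_at_within[OF modeD(3)[OF m, of x]] nz by (simp add: F_def distrib_right)
      have "((\<lambda>t. exp (- H t)) has_vector_derivative - F x * exp (- H x)) (at x within {0..2*pi})"
        using field_vector_diff_chain_within[OF has_vector_derivative_minus[OF dH[OF x]], of exp "exp (- H x)"]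
        by (simp add: o_def DERIV_exp has_field_derivative_at_within)
      from has_vector_derivative_mult[OF d this] show ?thesis by (simp add: algebra_simps)
    qed
    from norm_increment_bound[OF this, of 0 t 0] t
    have "\<phi> t * exp (- H t) = \<phi> 0 * exp (- H 0)" by simp
    also have "exp (- H 0) = 1 / \<phi> 0" using nz by (simp add: H_def exp_minus inverse_eq_divide)
    finally show ?thesis using nz[of 0] by (simp add: exp_minus field_simps)
  qed
  show thesis by (rule that[OF _ exp]) (use dH in \<open>simp_all add: F_def\<close>)
qed

text \<open>On the circle r = 1 the solution is \<open>\<phi>\<close> times a factor with positive
  real part. The principal logarithm of that factor is continuous and periodic, so \<open>w\<close>
  and \<open>\<phi>\<close> wind equally often.\<close>

lemma mode_winding_increment:
  assumes \<sigma>: "\<sigma> \<in> Spec lam nu c" and m: "mode \<sigma> \<phi> \<psi>" and nt: "\<phi> s \<noteq> 0 \<or> \<psi> s \<noteq> 0"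
    and w: "\<And>t. w (1, t) = separated \<sigma> \<phi> \<psi> (1, t)" and wind: "has_winding w j"
  obtains H where
    "\<And>t. t \<in> {0..2*pi} \<Longrightarrow> (H has_vector_derivative \<i> * (\<sigma> / lam - of_real nu) + c t / lam * (\<psi> t / \<phi> t))
        (at t within {0..2*pi})"
    "H (2*pi) - H 0 = 2 * of_real pi * \<i> * of_int j"
proof -
  have nz: "\<And>t. \<phi> t \<noteq> 0" by (rule mode_dominated(3)[OF \<sigma> m nt])
  obtain H where H:
    "\<And>t. t \<in> {0..2*pi} \<Longrightarrow> (H has_vector_derivative \<i> * (\<sigma> / lam - of_real nu) + c t / lam * (\<psi> t / \<phi> t))
        (at t within {0..2*pi})"
    "\<And>t. t \<in> {0..2*pi} \<Longrightarrow> \<phi> t = exp (H t)"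
    using mode_logarithm[OF m nz] by blast
  define z where "z t = 1 + cnj (\<psi> t) / \<phi> t" for t
  have w1: "w (1, t) = \<phi> t * z t" for t
    using nz[of t] by (simp add: w separated_def rpow_one z_def distrib_left)
  have Re_z: "0 < Re (z t)" for t
  proof (cases "Im \<sigma> = 0")
    case True
    then show ?thesis using nz[of t] by (simp add: z_def modeD(5)[OF m])
  next
    case False
    then have "norm (cnj (\<psi> t) / \<phi> t) < 1"
      using mode_dominated(1)[OF \<sigma> m nt False, of t] nz[of t] by (simp add: norm_divide)
    then have "\<bar>Re (cnj (\<psi> t) / \<phi> t)\<bar> < 1" using abs_Re_le_cmod order_le_less_trans by blast
    then show ?thesis by (simp add: z_def)
  qed
  then have Ln_z: "z t \<noteq> 0" "z t \<notin> \<real>\<^sub>\<le>\<^sub>0" for t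
    by (metis zero_complex.simps(1) less_irrefl) (metis Re_z complex_nonpos_Reals_iff not_less)
  have contz: "continuous_on S z" for S
    unfolding z_def by (intro continuous_intros mode_continuous[OF m]) (use nz in auto)
  have contH: "continuous_on {0..2*pi} H"
    using H(1) by (meson continuous_on_eq_continuous_within has_vector_derivative_continuous)
  have per: "\<phi> (2*pi) = \<phi> 0" "\<psi> (2*pi) = \<psi> 0"
    using modeD(1,2)[OF m, of 0] by simp_all
  have "(H (2*pi) + Ln (z (2*pi))) - (H 0 + Ln (z 0)) = 2 * of_real pi * \<i> * of_int j"
  proof (rule has_winding_log_increment[OF wind])
    show "w (1, 2*pi) = w (1, 0)" by (simp add: w1 z_def per)
    show "continuous_on {0..2*pi} (\<lambda>t. w (1, t))"
      unfolding w1 by (intro continuous_intros mode_continuous[OF m] contz)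
    show "continuous_on {0..2*pi} (\<lambda>t. H t + Ln (z t))"
      by (intro continuous_intros contH contz) (use Ln_z in auto)
    show "w (1, t) = exp (H t + Ln (z t))" if "t \<in> {0..2*pi}" for t
      using H(2)[OF that] Ln_z(1)[of t] by (simp add: w1 exp_add)
  qed
  then have "H (2*pi) - H 0 = 2 * of_real pi * \<i> * of_int j" by (simp add: z_def per)
  then show thesis using that H(1) by blast
qed

end

subsection \<open>Exponents and winding numbers\<close>

context spiral_operator begin

text \<open>The difference of the diagonal coefficients of the system, hence the linear coefficient
  in the Riccati equation for \<psi>/\<phi>.\<close>

definition riccati_rate :: "complex \<Rightarrow> complex" where
  "riccati_rate \<sigma> = - \<i> * (\<sigma> / lam + \<sigma> / cnj lam - 2 * of_real nu)"

lemma Re_riccati_rate: "Re (riccati_rate \<sigma>) = 2 * Re lam * Im \<sigma> / (norm lam)\<^sup>2"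
  by (simp add: riccati_rate_def Im_divide flip: cmod_power2 add_divide_distrib)

lemma riccati_rate_diff:
  "norm (riccati_rate \<sigma> - riccati_rate \<sigma>') = 2 * Re lam / (norm lam)\<^sup>2 * norm (\<sigma> - \<sigma>')"
proof -
  have "1 / lam + 1 / cnj lam = of_real (2 * Re lam / (norm lam)\<^sup>2)"
  proof -
    have "1 / lam + 1 / cnj lam = (lam + cnj lam) / (lam * cnj lam)"
      using lam_nonzero by (simp add: field_simps)
    also have "lam * cnj lam = of_real ((norm lam)\<^sup>2)" by (rule complex_norm_square[symmetric])
    also have "lam + cnj lam = of_real (2 * Re lam)" by (rule complex_add_cnj)
    finally show ?thesis by simp
  qed
  moreover have "riccati_rate \<sigma> - riccati_rate \<sigma>' = - \<i> * (\<sigma> - \<sigma>') * (1 / lam + 1 / cnj lam)"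
    by (simp add: riccati_rate_def algebra_simps diff_divide_distrib)
  ultimately show ?thesis
    using Re_pos by (simp only: norm_mult norm_of_real) simp
qed

lemma riccati_equation:
  assumes m: "mode \<sigma> \<phi> \<psi>" and nz: "\<And>t. \<phi> t \<noteq> 0"
  shows "((\<lambda>t. \<psi> t / \<phi> t) has_vector_derivative
     riccati_rate \<sigma> * (\<psi> t / \<phi> t) + cnj (c t / lam) - c t / lam * (\<psi> t / \<phi> t)\<^sup>2) (at t)"
proof -
  let ?A = "\<i> * (\<sigma> / lam - of_real nu)" and ?B = "- \<i> * (\<sigma> / cnj lam - of_real nu)" and ?X = "c t / lam"
  have inv: "((\<lambda>t. inverse (\<phi> t)) has_vector_derivative (?A * \<phi> t + ?X * \<psi> t) * - (inverse (\<phi> t) * inverse (\<phi> t))) (at t)"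
    using field_vector_diff_chain_at[OF modeD(3)[OF m, of t] DERIV_inverse[OF nz[of t]]]
    by (simp add: o_def numeral_2_eq_2)
  have "((\<lambda>t. \<psi> t * inverse (\<phi> t)) has_vector_derivative
     \<psi> t * ((?A * \<phi> t + ?X * \<psi> t) * - (inverse (\<phi> t) * inverse (\<phi> t)))
       + (?B * \<psi> t + cnj ?X * \<phi> t) * inverse (\<phi> t)) (at t)"
    by (rule has_vector_derivative_mult[OF modeD(4)[OF m] inv])
  moreover have "\<psi> t * ((?A * \<phi> t + ?X * \<psi> t) * - (inverse (\<phi> t) * inverse (\<phi> t)))
       + (?B * \<psi> t + cnj ?X * \<phi> t) * inverse (\<phi> t)
     = riccati_rate \<sigma> * (\<psi> t / \<phi> t) + cnj ?X - ?X * (\<psi> t / \<phi> t)\<^sup>2"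
  proof -
    have "\<psi> t * ((A * \<phi> t + X * \<psi> t) * - (inverse (\<phi> t) * inverse (\<phi> t)))
       + (B * \<psi> t + Y * \<phi> t) * inverse (\<phi> t) = (B - A) * (\<psi> t / \<phi> t) + Y - X * (\<psi> t / \<phi> t)\<^sup>2" for A B X Y
      using nz[of t] by (simp add: field_simps power2_eq_square)
    moreover have "riccati_rate \<sigma> = ?B - ?A" by (simp add: riccati_rate_def algebra_simps)
    ultimately show ?thesis by (simp only:)
  qed
  ultimately show ?thesis by (simp only: divide_inverse)
qed

text \<open>As |\<psi>/\<phi>| is at most 1, the remaining terms of the Riccati equation are bounded
  by 2M/|lam|. The maximum principle then makes the ratio small when the real part of the rate is
  large.\<close>

lemma mode_ratio_bound:
  assumes \<sigma>: "\<sigma> \<in> Spec lam nu c" and m: "mode \<sigma> \<phi> \<psi>" and nt: "\<phi> s \<noteq> 0 \<or> \<psi> s \<noteq> 0"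
  shows "\<bar>Re (riccati_rate \<sigma>)\<bar> * norm (\<psi> t / \<phi> t) \<le> 2 * M / norm lam"
proof (rule periodic_norm_bound)
  have nz: "\<And>t. \<phi> t \<noteq> 0" by (rule mode_dominated(3)[OF \<sigma> m nt])
  show "((\<lambda>t. \<psi> t / \<phi> t) has_vector_derivative
     riccati_rate \<sigma> * (\<psi> t / \<phi> t) + cnj (c t / lam) - c t / lam * (\<psi> t / \<phi> t)\<^sup>2) (at t)" for t
    by (rule riccati_equation[OF m nz])
  show "norm (riccati_rate \<sigma> * (\<psi> t / \<phi> t) + cnj (c t / lam) - c t / lam * (\<psi> t / \<phi> t)\<^sup>2
      - riccati_rate \<sigma> * (\<psi> t / \<phi> t)) \<le> 2 * M / norm lam" for t
  proof -
    have p: "norm (\<psi> t / \<phi> t) \<le> 1"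
      using mode_dominated(2)[OF \<sigma> m nt, of t] nz[of t] by (simp add: norm_divide)
    have "norm (cnj (c t / lam) - c t / lam * (\<psi> t / \<phi> t)\<^sup>2)
       \<le> norm (c t / lam) + norm (c t / lam) * (norm (\<psi> t / \<phi> t))\<^sup>2"
      by (metis norm_triangle_ineq4 complex_mod_cnj norm_mult norm_power)
    also have "\<dots> \<le> M / norm lam + M / norm lam * 1"
      using p M_pos by (intro add_mono mult_mono coefficient_bound power_le_one) auto
    finally show ?thesis by simp
  qed
qed (simp add: modeD(1,2)[OF m])

lemma basic_solution_in_Spec: "basic_solution lam nu c w \<sigma> \<Longrightarrow> \<sigma> \<in> Spec lam nu c"
  by (auto simp: Spec_def)

text \<open>The logarithmic derivative of \<open>\<phi>\<close> stays within M/|lam| of the constant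
  \<open>A\<close>, while its integral over the circle is 2 pi i j.\<close>

lemma basic_solution_exponent_near:
  assumes bs: "basic_solution lam nu c w \<sigma>" and wind: "has_winding w j"
  shows "norm (\<sigma> - lam * (of_real nu + of_int j)) \<le> M"
proof -
  obtain \<phi> \<psi> s where m: "mode \<sigma> \<phi> \<psi>" and w: "\<And>r t. 0 < r \<Longrightarrow> w (r, t) = separated \<sigma> \<phi> \<psi> (r, t)"
    and nt: "\<phi> s \<noteq> 0 \<or> \<psi> s \<noteq> 0"
    using basic_solution_mode[OF bs] by metis
  note \<sigma> = basic_solution_in_Spec[OF bs]
  have w1: "w (1, t) = separated \<sigma> \<phi> \<psi> (1, t)" for t using w[of 1] by simp
  define A where "A = \<i> * (\<sigma> / lam - of_real nu)"
  obtain H where H: "\<And>t. t \<in> {0..2*pi} \<Longrightarrow> (H has_vector_derivative A + c t / lam * (\<psi> t / \<phi> t)) (at t within {0..2*pi})"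
    "H (2*pi) - H 0 = 2 * of_real pi * \<i> * of_int j"
    using mode_winding_increment[OF \<sigma> m nt w1 wind] unfolding A_def by blast
  define K where "K t = H t - of_real t * A" for t
  have dK: "(K has_vector_derivative c t / lam * (\<psi> t / \<phi> t)) (at t within {0..2*pi})" if "t \<in> {0..2*pi}" for t
  proof -
    have "((\<lambda>t. of_real t * A) has_vector_derivative 1 * A) (at t within {0..2*pi})"
      by (intro has_vector_derivative_mult_left has_vector_derivative_of_real) (auto intro!: derivative_eq_intros)
    from has_vector_derivative_diff[OF H(1)[OF that] this] show ?thesis by (simp add: K_def[abs_def])
  qed
  have bd: "norm (c t / lam * (\<psi> t / \<phi> t)) \<le> M / norm lam" for t
  proof -
    have "norm (\<psi> t / \<phi> t) \<le> 1"
      using mode_dominated(2,3)[OF \<sigma> m nt, of t] by (simp add: norm_divide)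
    then have "norm (c t / lam * (\<psi> t / \<phi> t)) \<le> M / norm lam * 1"
      unfolding norm_mult using M_pos by (intro mult_mono coefficient_bound) auto
    then show ?thesis by simp
  qed
  have "norm (K (2*pi) - K 0) \<le> M / norm lam * \<bar>2*pi - 0\<bar>"
    by (rule norm_increment_bound[OF dK bd]) auto
  moreover have "K (2*pi) - K 0 = - (of_real (2*pi) * \<i> / lam) * (\<sigma> - lam * (of_real nu + of_int j))"
  proof -
    have "K (2*pi) - K 0 = 2 * of_real pi * \<i> * of_int j - 2 * of_real pi * A"
      using H(2) by (simp add: K_def algebra_simps)
    then show ?thesis using lam_nonzero by (simp add: A_def field_simps)
  qed
  ultimately have "2 * pi / norm lam * norm (\<sigma> - lam * (of_real nu + of_int j)) \<le> 2 * pi / norm lam * M"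
    by (simp add: norm_mult norm_divide mult.commute[of "2*pi"])
  then show ?thesis using lam_nonzero by (subst (asm) mult_le_cancel_left_pos) simp_all
qed

text \<open>Equal winding numbers make the increments of the two logarithms cancel, so the
  difference of the exponents is balanced by the mean of \<open>c\<close> times the difference of
  the ratios.\<close>

lemma exponent_difference_bound:
  assumes \<sigma>: "\<sigma> \<in> Spec lam nu c" and m: "mode \<sigma> \<phi> \<psi>" and nt: "\<phi> s \<noteq> 0 \<or> \<psi> s \<noteq> 0"
    and w: "\<And>t. w (1, t) = separated \<sigma> \<phi> \<psi> (1, t)" and wind: "has_winding w j"
    and \<sigma>': "\<sigma>' \<in> Spec lam nu c" and m': "mode \<sigma>' \<phi>' \<psi>'" and nt': "\<phi>' s' \<noteq> 0 \<or> \<psi>' s' \<noteq> 0"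
    and w': "\<And>t. w' (1, t) = separated \<sigma>' \<phi>' \<psi>' (1, t)" and wind': "has_winding w' j"
    and Q: "\<And>t. norm (\<psi> t / \<phi> t - \<psi>' t / \<phi>' t) \<le> Q"
  shows "norm (\<sigma> - \<sigma>') \<le> M * Q"
proof -
  define A where "A = \<i> * (\<sigma> / lam - of_real nu)"
  define A' where "A' = \<i> * (\<sigma>' / lam - of_real nu)"
  obtain H where H: "\<And>t. t \<in> {0..2*pi} \<Longrightarrow> (H has_vector_derivative A + c t / lam * (\<psi> t / \<phi> t)) (at t within {0..2*pi})"
    "H (2*pi) - H 0 = 2 * of_real pi * \<i> * of_int j"
    using mode_winding_increment[OF \<sigma> m nt w wind] unfolding A_def by blast
  obtain H' where H': "\<And>t. t \<in> {0..2*pi} \<Longrightarrow> (H' has_vector_derivative A' + c t / lam * (\<psi>' t / \<phi>' t)) (at t within {0..2*pi})"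
    "H' (2*pi) - H' 0 = 2 * of_real pi * \<i> * of_int j"
    using mode_winding_increment[OF \<sigma>' m' nt' w' wind'] unfolding A'_def by blast
  define K where "K t = H t - H' t - of_real t * (A - A')" for t
  have dK: "(K has_vector_derivative c t / lam * (\<psi> t / \<phi> t - \<psi>' t / \<phi>' t)) (at t within {0..2*pi})"
    if "t \<in> {0..2*pi}" for t
  proof -
    have "((\<lambda>t. of_real t * (A - A')) has_vector_derivative 1 * (A - A')) (at t within {0..2*pi})"
      by (intro has_vector_derivative_mult_left has_vector_derivative_of_real) (auto intro!: derivative_eq_intros)
    from has_vector_derivative_diff[OF has_vector_derivative_diff[OF H(1)[OF that] H'(1)[OF that]] this]
    show ?thesis by (simp add: K_def[abs_def] algebra_simps)
  qed
  have bd: "norm (c t / lam * (\<psi> t / \<phi> t - \<psi>' t / \<phi>' t)) \<le> M / norm lam * Q" for t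
    unfolding norm_mult[of "c t / lam"] using M_pos Q by (intro mult_mono coefficient_bound) auto
  have "norm (K (2*pi) - K 0) \<le> M / norm lam * Q * \<bar>2*pi - 0\<bar>"
    by (rule norm_increment_bound[OF dK bd]) auto
  moreover have "K (2*pi) - K 0 = - (of_real (2*pi) * \<i> / lam) * (\<sigma> - \<sigma>')"
  proof -
    have "K (2*pi) - K 0 = (H (2*pi) - H 0) - (H' (2*pi) - H' 0) - 2 * of_real pi * (A - A')"
      by (simp add: K_def algebra_simps)
    then show ?thesis unfolding H(2) H'(2) by (simp add: A_def A'_def algebra_simps diff_divide_distrib)
  qed
  ultimately have "2 * pi / norm lam * norm (\<sigma> - \<sigma>') \<le> 2 * pi / norm lam * (M * Q)"
    by (simp add: norm_mult norm_divide mult.commute[of "2*pi"])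
  then show ?thesis using lam_nonzero by (subst (asm) mult_le_cancel_left_pos) simp_all
qed

text \<open>The ratios \<open>\<psi>/\<phi>\<close> of the two modes solve Riccati equations with a large linear part, so
  their distance is controlled by a small multiple of the distance of the exponents, which
  in turn is controlled by the distance of the ratios.\<close>

lemma exponents_equal:
  assumes bs: "basic_solution lam nu c w \<sigma>" and wind: "has_winding w j"
    and bs': "basic_solution lam nu c w' \<sigma>'" and wind': "has_winding w' j"
    and large: "2 * Re lam / (norm lam)\<^sup>2 * M + 2 * M / norm lam < \<bar>Re (riccati_rate \<sigma>)\<bar>"
  shows "\<sigma> = \<sigma>'"
proof -
  obtain \<phi> \<psi> s where m: "mode \<sigma> \<phi> \<psi>" and w: "\<And>r t. 0 < r \<Longrightarrow> w (r, t) = separated \<sigma> \<phi> \<psi> (r, t)"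
    and nt: "\<phi> s \<noteq> 0 \<or> \<psi> s \<noteq> 0"
    using basic_solution_mode[OF bs] by metis
  obtain \<phi>' \<psi>' s' where m': "mode \<sigma>' \<phi>' \<psi>'" and w': "\<And>r t. 0 < r \<Longrightarrow> w' (r, t) = separated \<sigma>' \<phi>' \<psi>' (r, t)"
    and nt': "\<phi>' s' \<noteq> 0 \<or> \<psi>' s' \<noteq> 0"
    using basic_solution_mode[OF bs'] by metis
  note \<sigma> = basic_solution_in_Spec[OF bs] and \<sigma>' = basic_solution_in_Spec[OF bs']
  have nz: "\<And>t. \<phi> t \<noteq> 0" by (rule mode_dominated(3)[OF \<sigma> m nt])
  have nz': "\<And>t. \<phi>' t \<noteq> 0" by (rule mode_dominated(3)[OF \<sigma>' m' nt'])
  define p where "p t = \<psi> t / \<phi> t" for t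
  define p' where "p' t = \<psi>' t / \<phi>' t" for t
  have p: "norm (p t) \<le> 1" and p': "norm (p' t) \<le> 1" for t
    using mode_dominated(2)[OF \<sigma> m nt, of t] nz[of t] mode_dominated(2)[OF \<sigma>' m' nt', of t] nz'[of t]
    by (simp_all add: p_def p'_def norm_divide)
  define q where "q t = p t - p' t" for t
  have per: "q (t + 2*pi) = q t" for t
    by (simp add: q_def p_def p'_def modeD(1,2)[OF m] modeD(1,2)[OF m'])
  have "continuous_on UNIV (\<lambda>t. norm (q t))"
    unfolding q_def p_def p'_def
    by (intro continuous_intros mode_continuous[OF m] mode_continuous[OF m']) (use nz nz' in auto)
  then obtain t0 where t0: "\<And>t. norm (q t) \<le> norm (q t0)"
    using periodic_attains_max[of "\<lambda>t. norm (q t)"] per by auto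
  define Q where "Q = norm (q t0)"
  have diff: "norm (\<sigma> - \<sigma>') \<le> M * Q"
    by (rule exponent_difference_bound[OF \<sigma> m nt _ wind \<sigma>' m' nt' _ wind'])
       (use w w' t0 in \<open>simp_all add: q_def p_def p'_def Q_def\<close>)
  \<comment> \<open>The first summand accounts for the change of the rate, via |\<sigma> -
    \<sigma>'| <= M Q and |p'| <= 1; the second for p^2 - p'^2 = (p + p') q with |p + p'| <=
    2.\<close>
  define K where "K = 2 * Re lam / (norm lam)\<^sup>2 * M + 2 * M / norm lam"
  define q' where "q' t = (riccati_rate \<sigma> * p t + cnj (c t / lam) - c t / lam * (p t)\<^sup>2)
     - (riccati_rate \<sigma>' * p' t + cnj (c t / lam) - c t / lam * (p' t)\<^sup>2)" for t
  have "\<bar>Re (riccati_rate \<sigma>)\<bar> * norm (q t0) \<le> K * Q"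
  proof (rule periodic_norm_bound[of q, OF per])
    show "(q has_vector_derivative q' t) (at t)" for t
      unfolding q_def[abs_def] q'_def p_def p'_def
      by (intro has_vector_derivative_diff riccati_equation m m' nz nz')
    show "norm (q' t - riccati_rate \<sigma> * q t) \<le> K * Q" for t
    proof -
      have "q' t - riccati_rate \<sigma> * q t = (riccati_rate \<sigma> - riccati_rate \<sigma>') * p' t - c t / lam * ((p t + p' t) * q t)"
        by (simp add: q'_def q_def algebra_simps power2_eq_square diff_divide_distrib)
      also have "norm \<dots> \<le> norm (riccati_rate \<sigma> - riccati_rate \<sigma>') * norm (p' t)
           + norm (c t / lam) * (norm (p t + p' t) * norm (q t))"
        by (metis norm_triangle_ineq4 norm_mult)
      also have "\<dots> \<le> (2 * Re lam / (norm lam)\<^sup>2 * (M * Q)) * 1 + M / norm lam * (2 * Q)"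
      proof (intro add_mono mult_mono coefficient_bound)
        show "norm (riccati_rate \<sigma> - riccati_rate \<sigma>') \<le> 2 * Re lam / (norm lam)\<^sup>2 * (M * Q)"
          unfolding riccati_rate_diff using diff Re_pos by (intro mult_left_mono) auto
        show "norm (p t + p' t) \<le> 2" using norm_triangle_ineq[of "p t" "p' t"] p[of t] p'[of t] by linarith
      qed (use p' t0 M_pos Re_pos in \<open>auto simp: Q_def\<close>)
      also have "\<dots> = K * Q" by (simp add: K_def algebra_simps)
      finally show ?thesis .
    qed
  qed
  then have "(\<bar>Re (riccati_rate \<sigma>)\<bar> - K) * Q \<le> 0" by (simp add: Q_def algebra_simps)
  moreover have "0 < \<bar>Re (riccati_rate \<sigma>)\<bar> - K" using large by (simp add: K_def)
  ultimately have "Q \<le> 0" by (simp add: mult_le_0_iff)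
  then have "norm (\<sigma> - \<sigma>') \<le> 0" using diff M_pos by (metis mult_le_0_iff order_trans less_imp_le)
  then show ?thesis by simp
qed

text \<open>The quotient of the two solutions on the circle is either a real constant or nowhere
  real. In both cases its principal logarithm is continuous and periodic and adds nothing to the
  winding.\<close>

lemma same_exponent_same_winding:
  assumes bs: "basic_solution lam nu c w \<sigma>" and wind: "has_winding w j"
    and bs': "basic_solution lam nu c w' \<sigma>" and wind': "has_winding w' j'"
  shows "j = j'"
proof -
  obtain \<phi> \<psi> where m: "mode \<sigma> \<phi> \<psi>" and w: "\<And>r t. 0 < r \<Longrightarrow> w (r, t) = separated \<sigma> \<phi> \<psi> (r, t)"
    using basic_solution_mode[OF bs] by metis
  obtain \<phi>' \<psi>' where m': "mode \<sigma> \<phi>' \<psi>'" and w': "\<And>r t. 0 < r \<Longrightarrow> w' (r, t) = separated \<sigma> \<phi>' \<psi>' (r, t)"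
    using basic_solution_mode[OF bs'] by metis
  have w1: "w (1, t) = \<phi> t + cnj (\<psi> t)" and w1': "w' (1, t) = \<phi>' t + cnj (\<psi>' t)" for t
    by (simp_all add: w w' separated_def rpow_one)
  have nz: "w (1, t) \<noteq> 0" "w' (1, t) \<noteq> 0" for t
    using wind wind' by (auto simp: has_winding_def)
  define q where "q t = w (1, t) / w' (1, t)" for t
  have per: "w (1, 2*pi) = w (1, 0)" "w' (1, 2*pi) = w' (1, 0)"
    using modeD(1,2)[OF m, of 0] modeD(1,2)[OF m', of 0] by (simp_all add: w1 w1')
  have cont: "continuous_on {0..2*pi} (\<lambda>t. w (1, t))" "continuous_on {0..2*pi} (\<lambda>t. w' (1, t))"
    unfolding w1 w1' by (intro continuous_intros mode_continuous[OF m] mode_continuous[OF m'])+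
  \<comment> \<open>If \<open>q\<close> takes the real value \<open>x\<close>, then
    \<open>w - x * w'\<close> vanishes at a point; it comes from a mode with exponent
    \<open>\<sigma>\<close>, which by the lower bound must be trivial.\<close>
  have real_const: "q t = of_real x" if q0: "q t0 = of_real x" for t t0 x
  proof -
    let ?\<Phi> = "\<lambda>t. of_real 1 * \<phi> t + of_real (- x) * \<phi>' t"
    let ?\<Psi> = "\<lambda>t. of_real 1 * \<psi> t + of_real (- x) * \<psi>' t"
    have mc: "mode \<sigma> ?\<Phi> ?\<Psi>" by (rule mode_combination[OF m m'])
    have sep: "separated \<sigma> ?\<Phi> ?\<Psi> (1, t) = w (1, t) - of_real x * w' (1, t)" for t
      unfolding separated_combination by (simp add: w w')
    have zero: "separated \<sigma> ?\<Phi> ?\<Psi> (1, t0) = 0"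
      using q0 nz(2)[of t0] unfolding sep by (simp add: q_def field_simps)
    have "?\<Phi> t = 0 \<and> ?\<Psi> t = 0"
    proof (rule ccontr)
      assume "\<not> ?thesis"
      then have "?\<Phi> t \<noteq> 0 \<or> ?\<Psi> t \<noteq> 0" by blast
      from separated_lower_bound[OF basic_solution_in_Spec[OF bs] mc this]
      obtain C where "C > 0" "\<And>r t. 0 < r \<Longrightarrow> C * r powr Re \<sigma> \<le> norm (separated \<sigma> ?\<Phi> ?\<Psi> (r, t))"
        by blast
      from this(2)[of 1 t0] this(1) show False unfolding zero by simp
    qed
    then have "separated \<sigma> ?\<Phi> ?\<Psi> (1, t) = 0" unfolding separated_def by simp
    then show ?thesis using nz(2)[of t] unfolding sep by (simp add: q_def field_simps)
  qed
  have contq: "continuous_on {0..2*pi} q"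
    unfolding q_def by (intro continuous_intros cont) (use nz in auto)
  have contLn: "continuous_on {0..2*pi} (\<lambda>t. Ln (q t))"
  \<comment> \<open>A constant \<open>q\<close> may lie on the branch cut of \<open>Ln\<close>, but
    its logarithm is constant all the same.\<close>
  proof (cases "\<exists>t0. q t0 \<in> \<real>")
    case True
    then obtain t0 x where "q t0 = of_real x" by (auto elim: Reals_cases)
    then have "q = (\<lambda>_. of_real x)" using real_const by blast
    then show ?thesis by simp
  next
    case False
    then have "q t \<notin> \<real>\<^sub>\<le>\<^sub>0" for t using nonpos_Reals_subset_Reals by blast
    then show ?thesis by (intro continuous_intros contq) auto
  qed
  obtain k where k: "continuous_on {0..2*pi} k" "\<And>t. t \<in> {0..2*pi} \<Longrightarrow> w' (1, t) = exp (k t)"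
    "k (2*pi) - k 0 = 2 * of_real pi * \<i> * of_int j'"
    using has_winding_logarithm[OF wind' per(2) cont(2)] by blast
  have "(k (2*pi) + Ln (q (2*pi))) - (k 0 + Ln (q 0)) = 2 * of_real pi * \<i> * of_int j"
  proof (rule has_winding_log_increment[OF wind per(1) cont(1)])
    show "continuous_on {0..2*pi} (\<lambda>t. k t + Ln (q t))" by (intro continuous_intros k(1) contLn)
    show "w (1, t) = exp (k t + Ln (q t))" if "t \<in> {0..2*pi}" for t
      using k(2)[OF that] nz[of t] by (simp add: exp_add q_def field_simps)
  qed
  then have "2 * of_real pi * \<i> * (of_int j' :: complex) = 2 * of_real pi * \<i> * of_int j"
    using k(3) by (simp add: q_def per)
  then show ?thesis by simp
qed

section \<open>Estimates uniform in the winding number\<close>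

lemma basic_solution_exponent_bounds:
  assumes "basic_solution lam nu c w \<sigma>" and "has_winding w j"
  shows "\<bar>Re \<sigma> - Re lam * (nu + of_int j)\<bar> \<le> M"
    and "\<bar>Im \<sigma> - Im lam * (nu + of_int j)\<bar> \<le> M"
    and "\<bar>Im (\<sigma> / lam)\<bar> \<le> M / norm lam"
proof -
  let ?d = "\<sigma> - lam * (of_real nu + of_int j)"
  have d: "norm ?d \<le> M" by (rule basic_solution_exponent_near[OF assms])
  show "\<bar>Re \<sigma> - Re lam * (nu + of_int j)\<bar> \<le> M" "\<bar>Im \<sigma> - Im lam * (nu + of_int j)\<bar> \<le> M"
    using order_trans[OF abs_Re_le_cmod d] order_trans[OF abs_Im_le_cmod d] by simp_all
  \<comment> \<open>The part of the exponent that grows with \<open>j\<close> becomes real after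
    division by \<open>lam\<close>, so the imaginary part sees only the bounded error.\<close>
  have "\<sigma> / lam = ?d / lam + of_real (nu + of_int j)" using lam_nonzero by (simp add: field_simps)
  then have "Im (\<sigma> / lam) = Im (?d / lam)" by simp
  then show "\<bar>Im (\<sigma> / lam)\<bar> \<le> M / norm lam"
    using order_trans[OF abs_Im_le_cmod[of "?d / lam"]] d
    by (simp add: norm_divide divide_right_mono)
qed

text \<open>The growth rate of |\<phi>| is governed by \<open>Im (\<sigma> / lam)\<close> and by the
  coupling, both at most M/|lam|; therefore the constant does not depend on
  \<open>j\<close>.\<close>

lemma mode_harnack:
  assumes bs: "basic_solution lam nu c w \<sigma>" and wind: "has_winding w j"
    and m: "mode \<sigma> \<phi> \<psi>" and nt: "\<phi> s \<noteq> 0 \<or> \<psi> s \<noteq> 0" and t: "t \<in> {0..2*pi}"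
  shows "norm (\<phi> t) \<le> exp (4 * pi * M / norm lam) * norm (\<phi> 0)"
proof -
  define C where "C = 4 * M / norm lam"
  let ?A = "\<i> * (\<sigma> / lam - of_real nu)"
  have C: "0 \<le> C" using M_pos by (simp add: C_def)
  have "(norm (\<phi> t))\<^sup>2 \<le> (norm (\<phi> 0))\<^sup>2 * exp (C * \<bar>t - 0\<bar>)"
  proof (rule gronwall_two_sided)
    show "((\<lambda>t. (norm (\<phi> t))\<^sup>2) has_real_derivative 2 * Re (cnj (\<phi> t) * (?A * \<phi> t + c t / lam * \<psi> t))) (at t)" for t
      by (rule has_real_derivative_norm_squared[OF modeD(3)[OF m]])
    show "\<bar>2 * Re (cnj (\<phi> t) * (?A * \<phi> t + c t / lam * \<psi> t))\<bar> \<le> C * (norm (\<phi> t))\<^sup>2" for t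
    proof -
      have "Re (cnj z * (\<i> * (S - of_real nu) * z + v)) = - Im S * (norm z)\<^sup>2 + Re (cnj z * v)" for z S v
        by (simp add: cmod_power2) (simp add: power2_eq_square algebra_simps)
      then have "\<bar>Re (cnj (\<phi> t) * (?A * \<phi> t + c t / lam * \<psi> t))\<bar>
         \<le> \<bar>Im (\<sigma> / lam)\<bar> * (norm (\<phi> t))\<^sup>2 + \<bar>Re (cnj (\<phi> t) * (c t / lam * \<psi> t))\<bar>"
        by (metis abs_triangle_ineq abs_mult abs_minus_cancel abs_power2)
      also have "\<dots> \<le> M / norm lam * (norm (\<phi> t))\<^sup>2 + norm (\<phi> t) * (M / norm lam * norm (\<phi> t))"
      proof (intro add_mono mult_right_mono)
        show "\<bar>Im (\<sigma> / lam)\<bar> \<le> M / norm lam" by (rule basic_solution_exponent_bounds(3)[OF bs wind])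
        have "\<bar>Re (cnj (\<phi> t) * (c t / lam * \<psi> t))\<bar> \<le> norm (\<phi> t) * (norm (c t / lam) * norm (\<psi> t))"
          by (metis abs_Re_le_cmod complex_mod_cnj norm_mult)
        also have "\<dots> \<le> norm (\<phi> t) * (M / norm lam * norm (\<phi> t))"
          using M_pos mode_dominated(2)[OF basic_solution_in_Spec[OF bs] m nt]
          by (intro mult_mono coefficient_bound) auto
        finally show "\<bar>Re (cnj (\<phi> t) * (c t / lam * \<psi> t))\<bar> \<le> norm (\<phi> t) * (M / norm lam * norm (\<phi> t))" .
      qed simp
      finally have "\<bar>2 * Re (cnj (\<phi> t) * (?A * \<phi> t + c t / lam * \<psi> t))\<bar>
         \<le> 2 * (M / norm lam * (norm (\<phi> t))\<^sup>2 + norm (\<phi> t) * (M / norm lam * norm (\<phi> t)))"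
        unfolding abs_mult by simp
      also have "\<dots> = C * (norm (\<phi> t))\<^sup>2" by (simp add: C_def power2_eq_square)
      finally show ?thesis .
    qed
  qed
  also have "\<dots> \<le> (norm (\<phi> 0))\<^sup>2 * exp (C * (2*pi))"
    using t C by (intro mult_left_mono) (auto intro!: mult_left_mono)
  also have "\<dots> = (exp (4 * pi * M / norm lam) * norm (\<phi> 0))\<^sup>2"
    by (simp add: C_def power_mult_distrib exp_double[symmetric] mult_ac)
  finally show ?thesis by (rule power2_le_imp_le) simp
qed

text \<open>Here \<open>w\<close> only locates the exponent; the mode may be any combination with
  that exponent. From |\<psi>| <= |\<phi>|/2 come the factors 3/2 above and 1/2 below, whose
  quotient is 3; the Harnack bound moves the angle to 0.\<close>

lemma separated_radial_comparison:
  assumes bs: "basic_solution lam nu c w \<sigma>" and wind: "has_winding w j"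
    and m: "mode \<sigma> \<phi> \<psi>" and large: "4 * M / norm lam \<le> \<bar>Re (riccati_rate \<sigma>)\<bar>"
    and r: "0 < r" "0 < r0" and t: "t \<in> {0..2*pi}"
  shows "norm (separated \<sigma> \<phi> \<psi> (r, t))
    \<le> 3 * exp (4 * pi * M / norm lam) * (r / r0) powr Re \<sigma> * norm (separated \<sigma> \<phi> \<psi> (r0, 0))"
proof (cases "\<exists>s. \<phi> s \<noteq> 0 \<or> \<psi> s \<noteq> 0")
  case False
  then show ?thesis by (simp add: separated_def)
next
  case True
  then obtain s where nt: "\<phi> s \<noteq> 0 \<or> \<psi> s \<noteq> 0" by blast
  note \<sigma> = basic_solution_in_Spec[OF bs]
  let ?E = "exp (4 * pi * M / norm lam)"
  have half: "norm (\<psi> t) \<le> norm (\<phi> t) / 2" for t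
  proof -
    have "4 * M / norm lam * norm (\<psi> t / \<phi> t) \<le> \<bar>Re (riccati_rate \<sigma>)\<bar> * norm (\<psi> t / \<phi> t)"
      by (intro mult_right_mono large) simp
    also have "\<dots> \<le> 2 * M / norm lam" by (rule mode_ratio_bound[OF \<sigma> m nt])
    finally have "2 * M / norm lam * (2 * norm (\<psi> t / \<phi> t)) \<le> 2 * M / norm lam * 1" by simp
    then have "2 * norm (\<psi> t / \<phi> t) \<le> 1"
      using M_pos lam_nonzero by (subst (asm) mult_le_cancel_left_pos) simp_all
    then show ?thesis
      using mode_dominated(3)[OF \<sigma> m nt, of t] by (simp add: norm_divide field_simps)
  qed
  have "norm (separated \<sigma> \<phi> \<psi> (r, t)) \<le> r powr Re \<sigma> * (norm (\<phi> t) + norm (\<psi> t))"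
    by (rule norm_separated_le[OF r(1)])
  also have "\<dots> \<le> r powr Re \<sigma> * (3 / 2 * (?E * norm (\<phi> 0)))"
    using half[of t] mode_harnack[OF bs wind m nt t] by (intro mult_left_mono) auto
  also have "\<dots> = 3 * ?E * (r / r0) powr Re \<sigma> * (r0 powr Re \<sigma> * (norm (\<phi> 0) - norm (\<phi> 0) / 2))"
    using r by (simp add: powr_divide)
  also have "\<dots> \<le> 3 * ?E * (r / r0) powr Re \<sigma> * norm (separated \<sigma> \<phi> \<psi> (r0, 0))"
  proof (intro mult_left_mono)
    have "r0 powr Re \<sigma> * (norm (\<phi> 0) - norm (\<phi> 0) / 2) \<le> r0 powr Re \<sigma> * (norm (\<phi> 0) - norm (\<psi> 0))"
      using half[of 0] by (intro mult_left_mono) auto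
    then show "r0 powr Re \<sigma> * (norm (\<phi> 0) - norm (\<phi> 0) / 2) \<le> norm (separated \<sigma> \<phi> \<psi> (r0, 0))"
      using norm_separated_ge[OF r(2)] order_trans by blast
  qed simp
  finally show ?thesis .
qed

text \<open>\<open>Im \<sigma>\<close> is within \<open>M\<close> of
  \<open>Im lam * (nu + j)\<close>, which is unbounded in \<open>j\<close>, and the real part of the
  rate is a positive multiple of \<open>Im \<sigma>\<close>. Solving for |j| gives the threshold
  \<open>x\<close>.\<close>

lemma riccati_rate_large:
  "\<exists>N. \<forall>j w \<sigma>. N < \<bar>j\<bar> \<longrightarrow> basic_solution lam nu c w \<sigma> \<longrightarrow> has_winding w j
     \<longrightarrow> B < \<bar>Re (riccati_rate \<sigma>)\<bar>"
proof -
  define x where "x = (B * (norm lam)\<^sup>2 / (2 * Re lam) + M) / \<bar>Im lam\<bar> + \<bar>nu\<bar>"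
  show ?thesis
  proof (intro exI[of _ "\<lceil>x\<rceil>"] allI impI)
    fix j w \<sigma> assume j: "\<lceil>x\<rceil> < \<bar>j\<bar>" and bs: "basic_solution lam nu c w \<sigma>" and wind: "has_winding w j"
    have "x < \<bar>of_int j\<bar>" using j by linarith
    then have "(B * (norm lam)\<^sup>2 / (2 * Re lam) + M) / \<bar>Im lam\<bar> < \<bar>nu + of_int j\<bar>"
      unfolding x_def by linarith
    then have "B * (norm lam)\<^sup>2 / (2 * Re lam) + M < \<bar>Im lam * (nu + of_int j)\<bar>"
      using Im_nonzero by (simp add: pos_divide_less_eq abs_mult mult.commute)
    then have "B * (norm lam)\<^sup>2 / (2 * Re lam) < \<bar>Im \<sigma>\<bar>"
      using basic_solution_exponent_bounds(2)[OF bs wind] by linarith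
    then have "B < 2 * Re lam * \<bar>Im \<sigma>\<bar> / (norm lam)\<^sup>2"
      using Re_pos lam_nonzero by (simp add: field_simps)
    then show "B < \<bar>Re (riccati_rate \<sigma>)\<bar>"
      using Re_pos by (simp add: Re_riccati_rate abs_mult)
  qed
qed

section \<open>Finite sums of modes\<close>

lemma mode_sum:
  assumes "finite P" and "\<And>z. z \<in> P \<Longrightarrow> mode \<sigma> (\<Phi> z) (\<Psi> z)"
  shows "mode \<sigma> (\<lambda>t. \<Sum>z\<in>P. of_real (x z) * \<Phi> z t) (\<lambda>t. \<Sum>z\<in>P. of_real (x z) * \<Psi> z t)"
  using assms
proof (induction P rule: finite_induct)
  case empty
  then show ?case by (simp add: mode_def)
next
  case (insert z P)
  then have "mode \<sigma> (\<lambda>t. of_real (x z) * \<Phi> z t + of_real 1 * (\<Sum>z\<in>P. of_real (x z) * \<Phi> z t))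
     (\<lambda>t. of_real (x z) * \<Psi> z t + of_real 1 * (\<Sum>z\<in>P. of_real (x z) * \<Psi> z t))"
    by (intro mode_combination) auto
  then show ?case using insert.hyps by simp
qed

lemma separated_sum:
  "separated \<sigma> (\<lambda>t. \<Sum>z\<in>P. of_real (x z) * \<Phi> z t) (\<lambda>t. \<Sum>z\<in>P. of_real (x z) * \<Psi> z t) p
     = (\<Sum>z\<in>P. of_real (x z) * separated \<sigma> (\<Phi> z) (\<Psi> z) p)"
  by (cases p) (simp add: separated_def sum_distrib_left sum.distrib algebra_simps)

end

subsection \<open>Asymptotics at the origin\<close>

context spiral_operator begin

text \<open>If some coefficient were nonzero, the terms of least order would keep \<open>u\<close>
  away from zero near the origin. The angles of the zeros lie in one period because the Harnack
  estimate is stated there.\<close>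

lemma zeros_accumulate_imp_zero:
  assumes spec: "\<forall>\<sigma>\<in>Spec lam nu c. \<forall>\<sigma>'\<in>Spec lam nu c. Re \<sigma> = Re \<sigma>' \<longrightarrow> \<sigma> = \<sigma>'"
    and fo: "finite_order lam nu c R u" and R: "0 < R"
    and seq_in: "\<forall>n. 0 < rs n \<and> rs n < R \<and> ts n \<in> {0..2*pi}"
    and seq_lim: "rs \<longlonglongrightarrow> 0"
    and zeros: "\<forall>n. u (rs n, ts n) = 0"
    and rt: "0 < r" "r < R"
  shows "u (r, t) = 0"
proof -
  obtain s w \<sigma> a where
    data: "\<forall>j. basic_solution lam nu c (w j True) (\<sigma> j True) \<and>
             basic_solution lam nu c (w j False) (\<sigma> j False) \<and>
             has_winding (w j True) j \<and> has_winding (w j False) j \<and>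
             R_independent (w j True) (w j False)"
    and expansion: "\<forall>r t. 0 < r \<and> r < R \<longrightarrow>
           ((\<lambda>j. of_real (a j True) * w j True (r, t) + of_real (a j False) * w j False (r, t))
              has_sum u (r, t)) UNIV"
    and order: "\<forall>j b. Re (\<sigma> j b) < s \<longrightarrow> a j b = 0"
    using fo unfolding finite_order_def by blast
  define W where "W j p = of_real (a j True) * w j True p + of_real (a j False) * w j False p" for j p
  have W: "((\<lambda>j. W j (r, t)) has_sum u (r, t)) UNIV" if "0 < r" "r < R" for r t
    using expansion that by (simp add: W_def)
  have bs: "basic_solution lam nu c (w j b) (\<sigma> j b)" and wind: "has_winding (w j b) j" for j b
    using data by (cases b; simp)+
  have "\<exists>\<phi> \<psi>. mode (\<sigma> j b) \<phi> \<psi> \<and> (\<forall>r t. 0 < r \<longrightarrow> w j b (r, t) = separated (\<sigma> j b) \<phi> \<psi> (r, t))" for j b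
    using basic_solution_mode[OF bs] by metis
  then obtain \<Phi> \<Psi> where mode: "\<And>j b. mode (\<sigma> j b) (\<Phi> j b) (\<Psi> j b)"
    and sep: "\<And>j b r t. 0 < r \<Longrightarrow> w j b (r, t) = separated (\<sigma> j b) (\<Phi> j b) (\<Psi> j b) (r, t)"
    by metis
  define \<alpha> where "\<alpha> = (\<lambda>(j, b). Re (\<sigma> j b))"
  define Z where "Z = {(j, b). a j b \<noteq> 0}"
  show ?thesis
  proof (cases "Z = {}")
    case True
    then have "a j b = 0" for j b by (auto simp: Z_def)
    then have "((\<lambda>j. W j (r, t)) has_sum 0) UNIV" by (intro has_sum_0) (simp add: W_def)
    then show ?thesis using W[OF rt] has_sum_unique by blast
  next
    case False
    \<comment> \<open>Finite order bounds the real parts from below by \<open>s\<close>, and each is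
      within \<open>M\<close> of \<open>Re lam * (nu + j)\<close>, so \<open>j\<close> is confined
      to a bounded interval.\<close>
    have fin: "finite {z \<in> Z. \<alpha> z \<le> x}" for x
    proof (rule finite_subset)
      define lo where "lo = \<lfloor>(s - M) / Re lam - nu\<rfloor>"
      define hi where "hi = \<lceil>(x + M) / Re lam - nu\<rceil>"
      show "{z \<in> Z. \<alpha> z \<le> x} \<subseteq> {lo..hi} \<times> UNIV"
      proof (clarsimp simp: Z_def \<alpha>_def)
        fix j b assume "a j b \<noteq> 0" and le: "Re (\<sigma> j b) \<le> x"
        then have ge: "s \<le> Re (\<sigma> j b)" using order by force
        note near = basic_solution_exponent_bounds(1)[OF bs wind, of j b]
        have "(s - M) / Re lam \<le> nu + of_int j" "nu + of_int j \<le> (x + M) / Re lam"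
          using near le ge Re_pos by (simp_all add: pos_divide_le_eq pos_le_divide_eq mult.commute abs_le_iff)
        then show "lo \<le> j \<and> j \<le> hi" unfolding lo_def hi_def by linarith
      qed
    qed simp
    obtain z1 where z1: "z1 \<in> Z" using False by blast
    obtain z0 where z0: "z0 \<in> Z" and min: "\<And>z. z \<in> Z \<Longrightarrow> \<alpha> z0 \<le> \<alpha> z"
    proof -
      let ?A = "{z \<in> Z. \<alpha> z \<le> \<alpha> z1}"
      have "?A \<noteq> {}" using z1 by blast
      then obtain z0 where z0: "z0 \<in> ?A" "\<And>z. z \<in> ?A \<Longrightarrow> \<alpha> z0 \<le> \<alpha> z"
        using fin[of "\<alpha> z1"] by (metis (no_types, lifting) arg_min_if_finite(1) arg_min_least)
      have "\<alpha> z0 \<le> \<alpha> z" if "z \<in> Z" for z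
        using z0(1) z0(2)[of z] that by (cases "\<alpha> z \<le> \<alpha> z1") auto
      then show thesis using that z0(1) by blast
    qed
    define \<tau> where "\<tau> = \<alpha> z0"
    obtain j0 b0 where z0_eq: "z0 = (j0, b0)" by fastforce
    define P where "P = {z \<in> Z. \<alpha> z = \<tau>}"
    \<comment> \<open>The spectral hypothesis turns equal real parts into equal exponents, and equal
      exponents force equal winding numbers; thus \<open>P\<close> lies over the single index
      \<open>j0\<close>.\<close>
    have P_exp: "\<sigma> j b = \<sigma> j0 b0 \<and> j = j0" if "(j, b) \<in> P" for j b
    proof -
      have "Re (\<sigma> j b) = Re (\<sigma> j0 b0)" using that by (simp add: P_def \<tau>_def z0_eq \<alpha>_def)
      then have eq: "\<sigma> j b = \<sigma> j0 b0" using spec bs basic_solution_in_Spec by blast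
      then have "basic_solution lam nu c (w j0 b0) (\<sigma> j b)" using bs[of j0 b0] by simp
      from same_exponent_same_winding[OF bs wind this wind] have "j = j0" .
      with eq show ?thesis by blast
    qed
    obtain \<delta> where \<delta>: "0 < \<delta>" "\<delta> \<le> 1" "\<And>z. z \<in> Z - P \<Longrightarrow> \<tau> + \<delta> \<le> \<alpha> z"
    proof -
      \<comment> \<open>The gap above \<open>\<tau>\<close> is a minimum over finitely many
        exponents; inserting 1 keeps the set nonempty and ensures
        \<open>\<delta> \<le> 1\<close>.\<close>
      let ?B = "insert 1 ((\<lambda>z. \<alpha> z - \<tau>) ` ({z \<in> Z. \<alpha> z \<le> \<tau> + 1} - P))"
      have finB: "finite ?B" using fin by simp
      have "0 < x" if "x \<in> ?B" for x
        using that min by (force simp: P_def \<tau>_def order_less_le)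
      then have "0 < Min ?B" using finB by (subst Min_gr_iff) auto
      moreover have le1: "Min ?B \<le> 1" using finB by (intro Min_le) auto
      moreover have "\<tau> + Min ?B \<le> \<alpha> z" if "z \<in> Z - P" for z
      proof (cases "\<alpha> z \<le> \<tau> + 1")
        case True
        then have "Min ?B \<le> \<alpha> z - \<tau>" using that finB by (intro Min_le) auto
        then show ?thesis by simp
      qed (use le1 in linarith)
      ultimately show thesis using that by blast
    qed
    \<comment> \<open>The first threshold makes the two exponents of index \<open>j\<close>
      coincide, the second gives |\<psi>| <= |\<phi>|/2.\<close>
    define K where "K = max (2 * Re lam / (norm lam)\<^sup>2 * M + 2 * M / norm lam) (4 * M / norm lam)"
    obtain N1 where N1: "\<And>j w \<sigma>. N1 < \<bar>j\<bar> \<Longrightarrow> basic_solution lam nu c w \<sigma> \<Longrightarrow> has_winding w j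
        \<Longrightarrow> K < \<bar>Re (riccati_rate \<sigma>)\<bar>"
      using riccati_rate_large[of K] by blast
    \<comment> \<open>Outside \<open>J\<close> the rates exceed \<open>K\<close> and every occurring
      exponent has real part above \<open>\<tau> + 1\<close>.\<close>
    define S where "S = fst ` {z \<in> Z. \<alpha> z \<le> \<tau> + 1}"
    define J where "J = {- \<bar>N1\<bar>..\<bar>N1\<bar>} \<union> S"
    have finJ: "finite J" using fin by (simp add: J_def S_def)
    have PJ: "P \<subseteq> J \<times> UNIV"
      by (force simp: P_def J_def S_def)
    \<comment> \<open>The expansion converges at \<open>r0 < R\<close>, and
      \<open>r0 \<le> 1\<close> lets larger powers of \<open>r\<close> be estimated by smaller
      ones.\<close>
    define r0 where "r0 = min 1 (R / 2)"
    have r0: "0 < r0" "r0 < R" "r0 \<le> 1" using R by (auto simp: r0_def)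
    define E where "E = 3 * exp (4 * pi * M / norm lam)"
    have tail: "norm (W j (r, t)) \<le> E * (r / r0) powr (\<tau> + 1) * norm (W j (r0, 0))"
      if j: "j \<notin> J" and r: "0 < r" "r \<le> r0" and t: "t \<in> {0..2*pi}" for j r t
    proof (cases "a j True = 0 \<and> a j False = 0")
      case True
      then show ?thesis by (simp add: W_def)
    next
      case False
      have large: "K < \<bar>Re (riccati_rate (\<sigma> j b))\<bar>" for b
        using N1[OF _ bs wind, of j b] j by (auto simp: J_def)
      \<comment> \<open>With a common exponent the whole term \<open>W j\<close> is a single
        separated function, so the radial comparison applies to it despite possible cancellation
        between its two summands.\<close>
      have same: "\<sigma> j False = \<sigma> j True"
        using large[of False] by (intro exponents_equal[OF bs wind bs wind]) (simp add: K_def)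
      have \<alpha>j: "\<tau> + 1 \<le> Re (\<sigma> j True)"
      proof -
        obtain b where "(j, b) \<in> Z" using False by (auto simp: Z_def)
        then have "\<not> \<alpha> (j, b) \<le> \<tau> + 1" using j by (force simp: J_def S_def)
        then show ?thesis using same by (cases b) (simp_all add: \<alpha>_def)
      qed
      let ?\<phi> = "\<lambda>t. of_real (a j True) * \<Phi> j True t + of_real (a j False) * \<Phi> j False t"
      let ?\<psi> = "\<lambda>t. of_real (a j True) * \<Psi> j True t + of_real (a j False) * \<Psi> j False t"
      have m: "mode (\<sigma> j True) ?\<phi> ?\<psi>"
        using mode[of j False] by (intro mode_combination mode) (simp add: same)
      have Wsep: "W j (r, t) = separated (\<sigma> j True) ?\<phi> ?\<psi> (r, t)" if "0 < r" for r t
        unfolding separated_combination using that by (simp add: W_def sep same)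
      have "norm (W j (r, t)) \<le> E * (r / r0) powr Re (\<sigma> j True) * norm (W j (r0, 0))"
        unfolding Wsep[OF r(1)] Wsep[OF r0(1)] E_def
        by (rule separated_radial_comparison[OF bs wind m _ r(1) r0(1) t])
           (use large[of True] in \<open>simp add: K_def\<close>)
      also have "\<dots> \<le> E * (r / r0) powr (\<tau> + 1) * norm (W j (r0, 0))"
        using \<alpha>j r r0 by (intro mult_right_mono mult_left_mono powr_mono') (auto simp: E_def)
      finally show ?thesis .
    qed
    \<comment> \<open>Unordered summability in the complex numbers is absolute; the norms at the one
      point \<open>(r0, 0)\<close> dominate the tail for all smaller radii and all angles.\<close>
    have "(\<lambda>j. norm (W j (r0, 0))) summable_on UNIV"
      by (rule summable_on_iff_abs_summable_on_complex[THEN iffD1, OF has_sum_imp_summable[OF W[OF r0(1,2)]]])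
    then obtain T where T: "((\<lambda>j. norm (W j (r0, 0))) has_sum T) UNIV"
      by (auto simp: summable_on_def)
    have tail_sum: "norm (u (r, t) - (\<Sum>j\<in>J. W j (r, t))) \<le> E * (r / r0) powr (\<tau> + 1) * T"
      if r: "0 < r" "r \<le> r0" and t: "t \<in> {0..2*pi}" for r t
    proof (rule norm_infsum_le)
      \<comment> \<open>The finite sum is written as a finitely supported family, so that adding it
        cancels exactly the terms in \<open>J\<close>.\<close>
      have "((\<lambda>j. if j \<in> J then - W j (r, t) else 0) has_sum - (\<Sum>j\<in>J. W j (r, t))) UNIV"
        by (rule has_sum_finite_neutralI[OF finJ]) (auto simp: sum_negf)
      from has_sum_add[OF W[of r t] this] r r0
      show "((\<lambda>j. W j (r, t) + (if j \<in> J then - W j (r, t) else 0)) has_sum (u (r, t) - (\<Sum>j\<in>J. W j (r, t)))) UNIV"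
        by simp
      show "((\<lambda>j. E * (r / r0) powr (\<tau> + 1) * norm (W j (r0, 0))) has_sum (E * (r / r0) powr (\<tau> + 1) * T)) UNIV"
        by (rule has_sum_cmult_right[OF T])
      show "norm (W j (r, t) + (if j \<in> J then - W j (r, t) else 0)) \<le> E * (r / r0) powr (\<tau> + 1) * norm (W j (r0, 0))" for j
        using tail[OF _ r t, of j] by (auto simp: E_def)
    qed
    \<comment> \<open>\<open>L\<close> is the leading part of order \<open>\<tau>\<close>; the
      nonzero terms of \<open>rest\<close> have order at least
      \<open>\<tau> + \<delta>\<close>.\<close>
    define L where "L p = (\<Sum>(j, b)\<in>P. of_real (a j b) * w j b p)" for p
    define rest where "rest p = (\<Sum>(j, b)\<in>J \<times> UNIV - P. of_real (a j b) * w j b p)" for p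
    have split: "(\<Sum>j\<in>J. W j p) = L p + rest p" for p
    proof -
      have "(\<Sum>j\<in>J. W j p) = (\<Sum>j\<in>J. \<Sum>b\<in>UNIV. of_real (a j b) * w j b p)"
        by (simp add: W_def UNIV_bool add.commute)
      also have "\<dots> = (\<Sum>(j, b)\<in>J \<times> UNIV. of_real (a j b) * w j b p)"
        by (rule sum.cartesian_product)
      also have "\<dots> = L p + rest p"
        unfolding L_def rest_def
        by (subst sum.subset_diff[OF PJ]) (use finJ in \<open>simp_all add: add.commute\<close>)
      finally show ?thesis .
    qed
    have "\<exists>C\<ge>0. \<forall>r t. 0 < r \<longrightarrow> norm (w j b (r, t)) \<le> C * r powr Re (\<sigma> j b)" for j b
      using separated_upper_bound[OF mode[of j b]] sep by simp
    then obtain C where C: "\<And>j b. 0 \<le> C j b"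
      "\<And>j b r t. 0 < r \<Longrightarrow> norm (w j b (r, t)) \<le> C j b * r powr Re (\<sigma> j b)"
      by metis
    define D where "D = (\<Sum>(j, b)\<in>J \<times> UNIV - P. \<bar>a j b\<bar> * C j b)"
    have rest: "norm (rest (r, t)) \<le> D * r powr (\<tau> + \<delta>)" if r: "0 < r" "r \<le> r0" for r t
      unfolding rest_def D_def sum_distrib_right
    proof (rule sum_norm_le, clarify)
      fix j b assume nP: "(j, b) \<notin> P"
      show "norm (of_real (a j b) * w j b (r, t)) \<le> \<bar>a j b\<bar> * C j b * r powr (\<tau> + \<delta>)"
      proof (cases "a j b = 0")
        case False
        then have "\<tau> + \<delta> \<le> Re (\<sigma> j b)" using \<delta>(3)[of "(j, b)"] nP by (auto simp: Z_def \<alpha>_def)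
        then have "r powr Re (\<sigma> j b) \<le> r powr (\<tau> + \<delta>)" using r r0 by (intro powr_mono') auto
        then have "norm (w j b (r, t)) \<le> C j b * r powr (\<tau> + \<delta>)"
          using C(2)[OF r(1), of j b t] C(1)[of j b] mult_left_mono order_trans by blast
        then show ?thesis by (simp add: norm_mult mult.assoc mult_left_mono)
      qed simp
    qed
    obtain c0 where c0: "0 < c0" "\<And>r t. 0 < r \<Longrightarrow> c0 * r powr \<tau> \<le> norm (L (r, t))"
    proof -
      let ?\<phi> = "\<lambda>t. \<Sum>z\<in>P. of_real (a (fst z) (snd z)) * \<Phi> (fst z) (snd z) t"
      let ?\<psi> = "\<lambda>t. \<Sum>z\<in>P. of_real (a (fst z) (snd z)) * \<Psi> (fst z) (snd z) t"
      have finP: "finite P" using PJ finJ finite_subset by fastforce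
      have P_exp': "\<sigma> (fst z) (snd z) = \<sigma> j0 b0" if "z \<in> P" for z
        using P_exp[of "fst z" "snd z"] that by (cases z) auto
      have m: "mode (\<sigma> j0 b0) ?\<phi> ?\<psi>"
        by (rule mode_sum[OF finP]) (metis P_exp' mode)
      have Lsep: "L (r, t) = separated (\<sigma> j0 b0) ?\<phi> ?\<psi> (r, t)" if "0 < r" for r t
        unfolding separated_sum L_def case_prod_unfold using P_exp' sep[OF that]
        by (intro sum.cong) auto
      have "\<exists>s. ?\<phi> s \<noteq> 0 \<or> ?\<psi> s \<noteq> 0"
      proof (rule ccontr)
        assume "\<not> ?thesis"
        then have L0: "L (r, t) = 0" if "0 < r" for r t
          using Lsep[OF that] by (simp add: separated_def)
        \<comment> \<open>\<open>P\<close> may contain only one of the two indices over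
          \<open>j0\<close>; the other coefficient is then set to 0, and a vanishing
          \<open>L\<close> contradicts real independence.\<close>
        define x where "x b = (if (j0, b) \<in> P then a j0 b else 0)" for b
        have Lx: "L p = of_real (x True) * w j0 True p + of_real (x False) * w j0 False p" for p
        proof -
          have "L p = (\<Sum>z\<in>{j0} \<times> UNIV. if z \<in> P then of_real (a (fst z) (snd z)) * w (fst z) (snd z) p else 0)"
            unfolding L_def case_prod_unfold
            by (rule sum.mono_neutral_cong_left) (use P_exp in auto)
          also have "{j0} \<times> (UNIV :: bool set) = {(j0, True), (j0, False)}" by (auto simp: UNIV_bool)
          finally show ?thesis by (simp add: x_def)
        qed
        have "x True = 0 \<and> x False = 0"
          using data L0 unfolding R_independent_def Lx by blast
        moreover have "x b0 \<noteq> 0" using z0 by (simp add: x_def P_def \<tau>_def z0_eq Z_def)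
        ultimately show False by (cases b0) auto
      qed
      then obtain s where "?\<phi> s \<noteq> 0 \<or> ?\<psi> s \<noteq> 0" by blast
      from separated_lower_bound[OF basic_solution_in_Spec[OF bs] m this]
      obtain c0 where "0 < c0"
        "\<And>r t. 0 < r \<Longrightarrow> c0 * r powr Re (\<sigma> j0 b0) \<le> norm (separated (\<sigma> j0 b0) ?\<phi> ?\<psi> (r, t))"
        by blast
      then show thesis
        using that[of c0] Lsep by (simp add: \<tau>_def z0_eq \<alpha>_def)
    qed
    \<comment> \<open>Because \<open>\<delta> \<le> 1\<close>, the tail of order
      \<open>\<tau> + 1\<close> and \<open>rest\<close> can share the power
      \<open>\<tau> + \<delta>\<close>.\<close>
    define B where "B = E * (1 / r0) powr (\<tau> + 1) * T + D"
    have "0 \<le> T" using has_sum_nonneg[OF T] by simp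
    moreover have "0 \<le> D" unfolding D_def by (intro sum_nonneg) (use C(1) in auto)
    ultimately have B: "0 \<le> B" by (simp add: B_def E_def)
    have lower: "c0 * r powr \<tau> - B * r powr (\<tau> + \<delta>) \<le> norm (u (r, t))"
      if r: "0 < r" "r \<le> r0" and t: "t \<in> {0..2*pi}" for r t
    proof -
      have "E * (r / r0) powr (\<tau> + 1) * T = (E * (1 / r0) powr (\<tau> + 1) * T) * r powr (\<tau> + 1)"
        using r r0 by (simp add: powr_divide)
      also have "\<dots> \<le> (E * (1 / r0) powr (\<tau> + 1) * T) * r powr (\<tau> + \<delta>)"
        using r r0 \<delta> \<open>0 \<le> T\<close> by (intro mult_left_mono powr_mono') (auto simp: E_def)
      finally have "norm (u (r, t) - (\<Sum>j\<in>J. W j (r, t))) + norm (rest (r, t)) \<le> B * r powr (\<tau> + \<delta>)"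
        using tail_sum[OF r t] rest[OF r, of t] by (simp add: B_def distrib_right)
      moreover have "L (r, t) = u (r, t) - (u (r, t) - (\<Sum>j\<in>J. W j (r, t))) - rest (r, t)"
        by (simp add: split)
      then have "norm (L (r, t)) \<le> norm (u (r, t)) + norm (u (r, t) - (\<Sum>j\<in>J. W j (r, t))) + norm (rest (r, t))"
        by (metis (no_types, lifting) add_mono_thms_linordered_semiring(3) norm_triangle_ineq4 order_trans)
      ultimately show ?thesis using c0(2)[OF r(1), of t] by linarith
    qed
    have "\<forall>\<^sub>F n in sequentially. rs n < min r0 ((c0 / (B + 1)) powr (1 / \<delta>))"
      using seq_lim r0 c0(1) B by (intro order_tendstoD) auto
    \<comment> \<open>The radius bound solves (B + 1) r^\<delta> < c0; using \<open>B + 1\<close>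
      keeps the quotient meaningful when \<open>B = 0\<close>.\<close>
    then obtain n where n: "rs n < r0" "rs n < (c0 / (B + 1)) powr (1 / \<delta>)"
      by (auto simp: eventually_sequentially)
    let ?r = "rs n"
    have r: "0 < ?r" using seq_in by blast
    have "?r powr \<delta> < ((c0 / (B + 1)) powr (1 / \<delta>)) powr \<delta>"
      using n r \<delta>(1) by (intro powr_less_mono2) auto
    also have "\<dots> = c0 / (B + 1)" using \<delta>(1) c0(1) B by (simp add: powr_powr)
    finally have "(B + 1) * ?r powr \<delta> < c0" using B by (simp add: pos_less_divide_eq mult.commute)
    moreover have "B * ?r powr \<delta> \<le> (B + 1) * ?r powr \<delta>" by (intro mult_right_mono) auto
    ultimately have "B * ?r powr \<delta> < c0" by linarith
    then have "B * ?r powr \<delta> * ?r powr \<tau> < c0 * ?r powr \<tau>"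
      using r by (intro mult_strict_right_mono) auto
    moreover have "c0 * ?r powr \<tau> - B * ?r powr (\<tau> + \<delta>) \<le> norm (u (?r, ts n))"
      using lower[of ?r "ts n"] n r seq_in by simp
    moreover have "B * ?r powr (\<tau> + \<delta>) = B * ?r powr \<delta> * ?r powr \<tau>"
      by (simp add: powr_add)
    ultimately have "0 < norm (u (?r, ts n))" by linarith
    then show ?thesis using zeros by simp
  qed
qed

end

theorem theorem6p6:
  fixes a b nu R :: real and k :: nat and c :: "real \<Rightarrow> complex"
    and u :: "real \<times> real \<Rightarrow> complex"
    and rs ts :: "nat \<Rightarrow> real"
  assumes "a > 0" and "b \<noteq> 0" and "0 \<le> nu" and "nu < 1" and "k \<ge> 2"
    and "Ck_circle k c"
    and "R > 0"
    and spec: "\<forall>\<sigma>\<in>Spec (Complex a b) nu c. \<forall>\<sigma>'\<in>Spec (Complex a b) nu c.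
                 Re \<sigma> = Re \<sigma>' \<longrightarrow> \<sigma> = \<sigma>'"
    and sol: "L_solution (Complex a b) nu c {0<..<R} u"
    and fo: "finite_order (Complex a b) nu c R u"
    and seq_in: "\<forall>n. 0 < rs n \<and> rs n < R"
    and seq_lim: "rs \<longlonglongrightarrow> 0"
    and zeros: "\<forall>n. u (rs n, ts n) = 0"
  shows "\<forall>r t. 0 < r \<and> r < R \<longrightarrow> u (r, t) = 0"
proof -
  obtain f :: "nat \<Rightarrow> real \<Rightarrow> complex" where c_per: "\<And>t. c (t + 2*pi) = c t" and "f 0 = c"
    and "\<forall>i<k. \<forall>t. (f i has_vector_derivative f (Suc i) t) (at t)"
    using \<open>Ck_circle k c\<close> unfolding Ck_circle_def by blast
  then have "(c has_vector_derivative f 1 t) (at t)" for t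
    using \<open>k \<ge> 2\<close> by (metis One_nat_def Suc_1 Suc_le_lessD less_Suc_eq_0_disj less_le_trans pos2)
  then have c_cont: "continuous_on UNIV c"
    by (meson continuous_at_imp_continuous_on has_vector_derivative_continuous)
  then obtain m where m: "\<And>t. norm (c t) \<le> norm (c m)"
    using periodic_attains_max[of "\<lambda>t. norm (c t)"] c_per by (auto intro: continuous_on_norm)
  \<comment> \<open>The added 1 makes the bound positive even if \<open>c\<close> vanishes
    identically.\<close>
  interpret spiral_operator "Complex a b" nu c "norm (c m) + 1"
  proof
    show "norm (c t) \<le> norm (c m) + 1" for t using m[of t] by simp
  qed (use assms c_cont in \<open>auto simp: add_nonneg_pos\<close>)
  \<comment> \<open>Periodicity of \<open>u\<close> in the angle moves each zero into a single
    period.\<close>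
  have "\<exists>t'\<in>{0..2*pi}. u (rs n, t') = 0" for n
  proof -
    obtain i where i: "ts n + 2*pi * of_int i \<in> {0..2*pi}" using circle_representative by blast
    moreover have "u (rs n, ts n + 2*pi * of_int i) = u (rs n, ts n)"
      by (rule periodic_int_shift) (use sol seq_in in \<open>simp add: L_solution_def\<close>)
    ultimately show ?thesis using zeros by auto
  qed
  then obtain ts' where "\<And>n. ts' n \<in> {0..2*pi}" "\<And>n. u (rs n, ts' n) = 0" by metis
  then show ?thesis
    using zeros_accumulate_imp_zero[OF spec fo \<open>R > 0\<close> _ seq_lim] seq_in by blast
qed

end
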